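(* Let $k\in\mathbb{N}$ and let $T_i: [0,1] \rightarrow [0,1]$, $1 \leq i \leq k$, be measurable transformations such that for each $i = 1, \dots, k$ there are a partition $\mathcal{A}_i$ and a $T_i$-invariant ergodic measure $\mu_i$ with $(T_i, \mu_i, \mathcal{A}_i) \in \mathcal{T}$. Suppose that for each $i = 1, \dots, k$, $(T_i, \mu_i, \mathcal{A}_i)$ has properties E and M. If the entropy values $h(T_1), \dots, h(T_k)$ are distinct, then for any $f_1, \dots, f_k \in L^{\infty}(\lambda)$, $$\lim_{N \rightarrow \infty} \frac{1}{N} \sum_{n=0}^{N-1} f_1(T_1^n x) f_2(T_2^n x) \cdots f_k(T_k^n x) = \prod_{i=1}^k \int f_i \, d\mu_i$$ for almost every $x \in [0,1]$.
   Context: $\lambda$ is Lebesgue measure on $[0,1]$, $\mathcal{B}$ the Borel $\sigma$-algebra of $[0,1]$; "almost every" is with respect to $\lambda$; $\sigma(\cdot)$ denotes the generated $\sigma$-algebra. Class $\mathcal{T}$: the triples $(T,\mu,\mathcal{A})$ where $\mu$ is a probability measure on $\mathcal{B}$ such that for some $c\ge1$, $\frac1c\mu(A)\le\lambda(A)\le c\,\mu(A)$ for all $A\in\mathcal{B}$; $T:[0,1]\to[0,1]$ is a measurable, $\mu$-preserving, $\mu$-ergodic map; and $\mathcal{A}$ is a finite or countable partition of $[0,1]$ (up to a $\lambda$-null set) into intervals (open, closed, or half open) with nonempty and disjoint interiors such that for every $I\in\mathcal{A}$ the map $T|_{\mathrm{int}(I)}$ is continuous and strictly monotone; and moreover (1)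 $\mathcal{B}=\bigvee_{j=0}^\infty T^{-j}\sigma(\mathcal{A}) \bmod\lambda$, (2) $H(\mathcal{A}):=-\sum_{I\in\mathcal{A}}\mu(I)\log\mu(I)<\infty$. Write $\mathcal{A}^n:=\bigvee_{j=0}^{n-1}T^{-j}\mathcal{A}$, and let $h(T)$ be the Kolmogorov–Sinai entropy of $T$ with respect to $\mu$ (finite for members of $\mathcal{T}$). Property E: for any $\epsilon>0$ there is a real $c_0=c_0(\epsilon)>0$ such that for every $n\in\mathbb{N}$, $$\mu\left(\{x\in[0,1): x\in A\text{ for some }A\in\mathcal{A}^n\text{ with }e^{-n(h(T)+\epsilon)}\le\mu(A)\le e^{-n(h(T)-\epsilon)}\}\right)\ge1-\frac{c_0}{n}.$$ Property M: there is a sequence $(b_n)_{n\ge0}$ of non-negative reals with $\sum_n b_n<\infty$ such that for every natural number $l$, every integer $n\ge0$, every $A\in\sigma(\mathcal{A}^l)$ and every $B\in\mathcal{B}$, $$|\lambda(A\cap T^{-(n+l)}B)-\lambda(A)\mu(B)|\le b_n.$$ *)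

theory Defs
  imports "HOL-Probability.Probability"
begin

definition leb01 :: "real measure" where
  "leb01 = restrict_space lborel {0..1}"

definition measure_preserving_map :: "'a measure \<Rightarrow> ('a \<Rightarrow> 'a) \<Rightarrow> bool" where
  "measure_preserving_map M T \<longleftrightarrow> T \<in> measurable M M \<and> distr M M T = M"

definition ergodic_map :: "'a measure \<Rightarrow> ('a \<Rightarrow> 'a) \<Rightarrow> bool" where
  "ergodic_map M T \<longleftrightarrow>
     (\<forall>B\<in>sets M. T -` B \<inter> space M = B \<longrightarrow> measure M B = 0 \<or> measure M B = 1)"

text \<open>The refinement of \<open>P\<close> under \<open>T\<close>, that is, the join of the preimages of \<open>P\<close> under the
  iterates \<open>T ^^ j\<close> with \<open>j < n\<close>. For \<open>n = 0\<close> it is the trivial partition.\<close>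

definition iter_join :: "'a set \<Rightarrow> ('a \<Rightarrow> 'a) \<Rightarrow> 'a set set \<Rightarrow> nat \<Rightarrow> 'a set set" where
  "iter_join X T P n =
     {X \<inter> (\<Inter>j<n. (T ^^ j) -` a j) | a. \<forall>j<n. a j \<in> P} - {{}}"

definition sigma_join :: "'a set \<Rightarrow> ('a \<Rightarrow> 'a) \<Rightarrow> 'a set set \<Rightarrow> 'a set set" where
  "sigma_join X T P =
     sigma_sets X (\<Union>j. {(T ^^ j) -` S \<inter> X | S. S \<in> sigma_sets X P})"

definition eq_mod :: "'a measure \<Rightarrow> 'a set set \<Rightarrow> 'a set set \<Rightarrow> bool" where
  "eq_mod M F G \<longleftrightarrow>
     (\<forall>A\<in>F. \<exists>B\<in>G. sym_diff A B \<in> null_sets M) \<and>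
     (\<forall>B\<in>G. \<exists>A\<in>F. sym_diff A B \<in> null_sets M)"

text \<open>Entropy of a finite or countable partition, with values in \<open>[0, \<infinity>]\<close>.\<close>

definition partition_entropy :: "'a measure \<Rightarrow> 'a set set \<Rightarrow> ennreal" where
  "partition_entropy M P = (\<Sum>\<^sub>\<infinity>A\<in>P. ennreal (- measure M A * ln (measure M A)))"

definition finite_partition :: "'a measure \<Rightarrow> 'a set set \<Rightarrow> bool" where
  "finite_partition M P \<longleftrightarrow> finite P \<and> P \<subseteq> sets M \<and> disjoint P \<and> \<Union>P = space M"

definition entropy_wrt :: "'a measure \<Rightarrow> ('a \<Rightarrow> 'a) \<Rightarrow> 'a set set \<Rightarrow> ennreal" where
  "entropy_wrt M T P =
     lim (\<lambda>n. partition_entropy M (iter_join (space M) T P n) / of_nat n)"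

text \<open>Kolmogorov-Sinai entropy as a real number. The supremum is finite for every member of the
  class below, because its partition generates and has finite entropy; in general
  \<open>enn2real\<close> would turn an infinite supremum into \<open>0\<close>.\<close>

definition ks_entropy :: "'a measure \<Rightarrow> ('a \<Rightarrow> 'a) \<Rightarrow> real" where
  "ks_entropy M T = enn2real (SUP P \<in> {P. finite_partition M P}. entropy_wrt M T P)"

text \<open>The members of \<open>P\<close> may overlap in endpoints. Interiors are taken in the real line.\<close>

definition interval_partition :: "real set set \<Rightarrow> bool" where
  "interval_partition P \<longleftrightarrow>
     countable P \<and>
     (\<forall>I\<in>P. is_interval I \<and> I \<subseteq> {0..1} \<and> interior I \<noteq> {}) \<and>
     disjoint_family_on interior P \<and>
     {0..1} - \<Union>P \<in> null_sets leb01"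

text \<open>The values of \<open>T\<close> outside \<open>[0, 1]\<close> play no role.\<close>

definition class_T :: "(real \<Rightarrow> real) \<Rightarrow> real measure \<Rightarrow> real set set \<Rightarrow> bool" where
  "class_T T \<mu> P \<longleftrightarrow>
     prob_space \<mu> \<and>
     sets \<mu> = sets (restrict_space borel {0..1}) \<and>
     (\<exists>c\<ge>1. \<forall>A\<in>sets \<mu>. 1 / c * measure \<mu> A \<le> measure leb01 A \<and>
                        measure leb01 A \<le> c * measure \<mu> A) \<and>
     measure_preserving_map \<mu> T \<and>
     ergodic_map \<mu> T \<and>
     interval_partition P \<and>
     (\<forall>I\<in>P. continuous_on (interior I) T \<and>
        (strict_mono_on (interior I) T \<or> strict_antimono_on (interior I) T)) \<and>
     eq_mod leb01 (sets \<mu>) (sigma_join {0..1} T P) \<and>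
     partition_entropy \<mu> P < \<infinity>"

definition property_E :: "(real \<Rightarrow> real) \<Rightarrow> real measure \<Rightarrow> real set set \<Rightarrow> bool" where
  "property_E T \<mu> P \<longleftrightarrow>
     (\<forall>\<epsilon>>0. \<exists>c0>0. \<forall>n\<ge>1.
        measure \<mu> {x \<in> {0..<1}. \<exists>A\<in>iter_join {0..1} T P n. x \<in> A \<and>
            exp (- real n * (ks_entropy \<mu> T + \<epsilon>)) \<le> measure \<mu> A \<and>
            measure \<mu> A \<le> exp (- real n * (ks_entropy \<mu> T - \<epsilon>))}
          \<ge> 1 - c0 / real n)"

definition property_M :: "(real \<Rightarrow> real) \<Rightarrow> real measure \<Rightarrow> real set set \<Rightarrow> bool" where
  "property_M T \<mu> P \<longleftrightarrow>
     (\<exists>b :: nat \<Rightarrow> real. (\<forall>n. 0 \<le> b n) \<and> summable b \<and>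
        (\<forall>l\<ge>1. \<forall>n. \<forall>A\<in>sigma_sets {0..1} (iter_join {0..1} T P l). \<forall>B\<in>sets \<mu>.
           \<bar>measure leb01 (A \<inter> (T ^^ (n + l)) -` B) - measure leb01 A * measure \<mu> B\<bar> \<le> b n))"

definition L_infinity :: "'a measure \<Rightarrow> ('a \<Rightarrow> complex) set" where
  "L_infinity M = {f \<in> borel_measurable M. \<exists>C. AE x in M. norm (f x) \<le> C}"

end

theory Submission
  imports Defs
begin

text \<open>Order the systems by entropy and telescope the product, so that the factor of largest entropy
  in each term has mean zero. For indicators of cylinder sets the averages tend to zero as soon as
  the correlation of the terms at times \<open>n \<le> m\<close> is of order \<open>1 / (m - n + 1)\<close>. By property E, a
  union of length-\<open>m\<close> cylinders of a system of smaller entropy consists, up to measure of order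
  \<open>1 / m\<close>, of few intervals, far fewer than the length-\<open>p\<close> cylinders of the leading
  system when \<open>p / m < 1\<close> is close to \<open>1\<close>; hence it is almost a union of the latter. Property M of
  the leading system, applied at time \<open>p\<close>, then decorrelates the mean-zero factor at time \<open>m\<close>.
  The maximal ergodic inequality and the generating property extend the result from cylinder sets
  to Borel sets, and uniform approximation by functions with finite range to bounded functions.\<close>

section \<open>A strong law of large numbers and a maximal inequality\<close>


text \<open>The partitions of different systems are unrelated; all that the systems share is the
  order of the unit interval and the null sets of \<lambda>. Entropy enters by counting. If
  \<open>h < H\<close> are a slightly enlarged smaller entropy and a slightly reduced leading
  entropy, at most about \<open>exp (m * h)\<close> intervals matter for the smaller system, a
  leading fibre of length \<open>p\<close> weighs at most \<open>exp (- p * H)\<close>, and only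
  fibres through the two end points of an interval are cut. The loss
  \<open>2 * exp (m * h - p * H)\<close> is small once \<open>p / m\<close> stays above
  \<open>h / H\<close>, and since \<open>h / H < 1\<close> this still leaves a mixing gap
  \<open>m - p\<close> proportional to \<open>m\<close>. Equal entropies would leave no such room.
  Property E controls exceptional points at rate \<open>1 / n\<close>, which dictates the harmonic
  rate in the strong law. Such rates are available for cylinder sets only, and closeness in measure
  does not preserve convergence almost everywhere; the maximal inequality repairs this by making
  approximation errors uniform in the number of terms.\<close>

lemma sum_inverse_le_sqrt: "(\<Sum>r<N. 1 / real (Suc r)) \<le> 2 * sqrt (real N)"
proof (induction N)
  case (Suc N)
  have "1 / real (Suc N) \<le> 2 * (sqrt (real (Suc N)) - sqrt (real N))"
  proof -
    let ?a = "sqrt (real (Suc N))" and ?b = "sqrt (real N)"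
    have a: "?a \<ge> 1" "?b \<le> ?a" "?b \<ge> 0" by auto
    have aa: "?a * ?a = real (Suc N)" "?b * ?b = real N" by simp_all
    have "(?a - ?b) * (?a + ?b) = 1" using aa by (simp add: algebra_simps)
    moreover have "?a + ?b \<noteq> 0" using a by linarith
    ultimately have eq: "?a - ?b = 1 / (?a + ?b)" by (simp only: eq_divide_eq) simp
    have "?a + ?b \<le> 2 * (?a * ?a)" using a mult_left_mono[of 1 ?a ?a] by linarith
    then have "?a + ?b \<le> 2 * real (Suc N)" using aa by metis
    then have "2 / (2 * real (Suc N)) \<le> 2 / (?a + ?b)" using a by (intro frac_le) linarith+
    also have "2 / (2 * real (Suc N)) = 1 / real (Suc N)" by (simp del: of_nat_Suc)
    finally show ?thesis unfolding eq by simp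
  qed
  then show ?case using Suc by simp
qed simp

text \<open>The series of the \<open>Y j\<close> has finite integral, so it converges at almost
  every point, and terms of a convergent series tend to zero.\<close>

lemma AE_tendsto_zero_if_summable_integrals:
  fixes Y :: "nat \<Rightarrow> 'a \<Rightarrow> real"
  assumes [measurable]: "\<And>j. Y j \<in> borel_measurable M" and nonneg: "\<And>j x. 0 \<le> Y j x"
    and int: "\<And>j. integrable M (Y j)"
    and bound: "\<And>j. (\<integral>x. Y j x \<partial>M) \<le> c j" and "summable c"
  shows "AE x in M. (\<lambda>j. Y j x) \<longlonglongrightarrow> 0"
proof -
  have c0: "0 \<le> c j" for j
    using bound[of j] Bochner_Integration.integral_nonneg[of M "Y j"] nonneg by (meson order_trans)
  have "(\<integral>\<^sup>+x. (\<Sum>j. ennreal (Y j x)) \<partial>M) = (\<Sum>j. \<integral>\<^sup>+x. ennreal (Y j x) \<partial>M)"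
    by (rule nn_integral_suminf) simp
  also have "\<dots> \<le> (\<Sum>j. ennreal (c j))"
    using bound nonneg int by (intro suminf_le) (auto simp: nn_integral_eq_integral ennreal_leI)
  also have "\<dots> = ennreal (suminf c)"
    using c0 \<open>summable c\<close> by (intro suminf_ennreal2) auto
  finally have "(\<integral>\<^sup>+x. (\<Sum>j. ennreal (Y j x)) \<partial>M) \<noteq> \<infinity>"
    by (auto simp: top_unique)
  then have "AE x in M. (\<Sum>j. ennreal (Y j x)) \<noteq> \<infinity>"
    by (intro nn_integral_PInf_AE) auto
  then show ?thesis
  proof (rule AE_mp, intro AE_I2 impI)
    fix x assume "(\<Sum>j. ennreal (Y j x)) \<noteq> \<infinity>"
    then have "summable (\<lambda>j. Y j x)"
      using nonneg by (intro summable_suminf_not_top) (auto simp: infinity_ennreal_def)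
    then show "(\<lambda>j. Y j x) \<longlonglongrightarrow> 0" by (rule summable_LIMSEQ_zero)
  qed
qed

text \<open>Gaps between consecutive fourth powers are of order \<open>j ^ 3\<close>, negligible
  against \<open>j ^ 4\<close>, so bounded terms cannot move the average much in between. Fourth
  powers are sparse enough for the variance bound of the strong law below to become
  summable.\<close>

lemma average_tendsto_zero_if_subsequence:
  fixes X :: "nat \<Rightarrow> real"
  assumes bd: "\<And>n. \<bar>X n\<bar> \<le> 1"
    and sub: "(\<lambda>j. (\<Sum>n<Suc j ^ 4. X n) / real (Suc j ^ 4)) \<longlonglongrightarrow> 0"
  shows "(\<lambda>N. (\<Sum>n<N. X n) / real N) \<longlonglongrightarrow> 0"
proof (rule tendsto_rabs_zero_cancel, rule metric_LIMSEQ_I)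
  fix e :: real assume "0 < e"
  define S where "S N = (\<Sum>n<N. X n)" for N
  have "0 < e / 2" using \<open>0 < e\<close> by simp
  from metric_LIMSEQ_D[OF sub this] obtain j0 where
    "\<And>j. j \<ge> j0 \<Longrightarrow> dist (S (Suc j ^ 4) / real (Suc j ^ 4)) 0 < e / 2"
    unfolding S_def by blast
  then have j0: "\<And>j. j \<ge> j0 \<Longrightarrow> \<bar>S (Suc j ^ 4)\<bar> / real (Suc j ^ 4) < e / 2"
    by (simp only: dist_real_def abs_divide diff_zero abs_of_nat)
  \<comment> \<open>The terms after \<open>j ^ 4\<close> contribute at most \<open>15 / j\<close> to
    the average, because \<open>(j + 1) ^ 4 - j ^ 4\<close> is at most
    \<open>(4 + 6 + 4 + 1) * j ^ 3\<close>. This choice puts the contribution below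
    \<open>e / 2\<close>.\<close>
  obtain j1 :: nat where j1: "30 / e < real j1" using reals_Archimedean2 by blast
  define J where "J = Suc (max j0 j1)"
  show "\<exists>no. \<forall>N\<ge>no. dist \<bar>(\<Sum>n<N. X n) / real N\<bar> 0 < e"
  proof (intro exI allI impI)
    fix N assume N: "J ^ 4 \<le> N"
    define j where "j = (GREATEST j. j ^ 4 \<le> N)"
    have bnd: "y \<le> N" if "y ^ 4 \<le> N" for y
    proof (cases "y = 0")
      case False
      then have "y \<le> y ^ 4" by (intro self_le_power) auto
      with that show ?thesis by simp
    qed simp
    have jN: "j ^ 4 \<le> N" unfolding j_def by (rule GreatestI_nat[where P="\<lambda>j. j ^ 4 \<le> N", OF N bnd]) auto
    have jJ: "J \<le> j" unfolding j_def by (rule Greatest_le_nat[where P="\<lambda>j. j ^ 4 \<le> N", OF N bnd]) auto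
    have "\<not> Suc j ^ 4 \<le> N"
    proof
      assume "Suc j ^ 4 \<le> N"
      then have "Suc j \<le> j" unfolding j_def by (rule Greatest_le_nat[where P="\<lambda>j. j ^ 4 \<le> N", OF _ bnd]) auto
      then show False by simp
    qed
    then have Nj: "N < Suc j ^ 4" by simp
    have j_pos: "j \<ge> 1" using jJ J_def by simp
    have "S N = S (j ^ 4) + (\<Sum>n=j^4..<N. X n)"
      unfolding S_def using jN by (metis lessThan_atLeast0 sum.atLeastLessThan_concat zero_le)
    moreover have "\<bar>\<Sum>n=j^4..<N. X n\<bar> \<le> real (N - j ^ 4)"
      by (rule order_trans[OF sum_abs])
        (use sum_bounded_above[of "{j^4..<N}" "\<lambda>n. \<bar>X n\<bar>" 1] bd in simp)
    moreover have "real (N - j ^ 4) \<le> 15 * real j ^ 3"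
    proof -
      have "real N \<le> (real j + 1) ^ 4" using Nj by (metis of_nat_Suc of_nat_power less_imp_le of_nat_le_iff add.commute)
      also have "\<dots> = real j ^ 4 + 4 * real j ^ 3 + 6 * real j ^ 2 + 4 * real j + 1"
        by (simp add: power4_eq_xxxx power3_eq_cube power2_eq_square algebra_simps)
      also have "\<dots> \<le> real j ^ 4 + 15 * real j ^ 3"
      proof -
        have "1 \<le> real j" using j_pos by simp
        from power_increasing[OF _ this, of 2 3] power_increasing[OF _ this, of 1 3]
          power_increasing[OF _ this, of 0 3]
        show ?thesis unfolding power_one_right power_0 by linarith
      qed
      finally show ?thesis using jN by (simp add: of_nat_diff)
    qed
    ultimately have "\<bar>S N\<bar> \<le> \<bar>S (j ^ 4)\<bar> + 15 * real j ^ 3" by linarith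
    then have "\<bar>S N\<bar> / real N \<le> (\<bar>S (j ^ 4)\<bar> + 15 * real j ^ 3) / real (j ^ 4)"
      using jN j_pos by (intro frac_le) auto
    also have "\<dots> = \<bar>S (j ^ 4)\<bar> / real (j ^ 4) + 15 / real j"
      using j_pos by (simp add: add_divide_distrib power4_eq_xxxx power3_eq_cube)
    also have "\<dots> < e / 2 + e / 2"
    proof -
      have "\<bar>S (j ^ 4)\<bar> / real (j ^ 4) < e / 2"
        using j0[of "j - 1"] jJ by (simp add: J_def)
      moreover have "30 / e < real j" using j1 jJ by (simp add: J_def)
      then have "15 / real j < e / 2" using \<open>0 < e\<close> j_pos by (simp add: field_simps)
      ultimately show ?thesis by linarith
    qed
    finally show "dist \<bar>(\<Sum>n<N. X n) / real N\<bar> 0 < e"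
      by (simp add: S_def abs_divide)
  qed
qed

text \<open>Adding one term to the partial sum raises its second moment by at most a harmonic sum.
  Bounding that sum by a square root instead of a logarithm gives the second moment order
  \<open>N * sqrt N\<close>; after division by \<open>N ^ 2\<close> and restriction to
  \<open>N = (j + 1) ^ 4\<close> it is of order \<open>1 / (j + 1) ^ 2\<close>, which is
  summable.\<close>

lemma (in prob_space) strong_law_of_correlation_decay:
  fixes X :: "nat \<Rightarrow> 'a \<Rightarrow> real"
  assumes [measurable]: "\<And>n. X n \<in> borel_measurable M" and bd: "\<And>n x. \<bar>X n x\<bar> \<le> 1"
    and "0 \<le> C"
    and corr: "\<And>n m. n \<le> m \<Longrightarrow> \<bar>expectation (\<lambda>x. X n x * X m x)\<bar> \<le> C / real (Suc (m - n))"
  shows "AE x in M. (\<lambda>N. (\<Sum>n<N. X n x) / real N) \<longlonglongrightarrow> 0"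
proof -
  define S where "S N x = (\<Sum>n<N. X n x)" for N x
  have [measurable]: "S N \<in> borel_measurable M" for N unfolding S_def by measurable
  have intX: "integrable M (\<lambda>x. X n x * X m x)" for n m
    using bd by (intro integrable_const_bound[where B=1]) (auto simp: abs_mult mult_le_one)
  have Ssq: "(S N x)\<^sup>2 = (\<Sum>n<N. \<Sum>m<N. X n x * X m x)" for N x
    by (simp add: S_def power2_eq_square sum_product)
  have intS: "integrable M (\<lambda>x. (S N x)\<^sup>2)" for N
    unfolding Ssq by (intro Bochner_Integration.integrable_sum intX)
  have ES: "expectation (\<lambda>x. (S N x)\<^sup>2) \<le> 4 * C * (real N * sqrt (real N))" for N
  proof (induction N)
    case 0
    then show ?case by (simp add: S_def)
  next
    case (Suc N)
    have "expectation (\<lambda>x. (S (Suc N) x)\<^sup>2)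
        = expectation (\<lambda>x. (S N x)\<^sup>2 + (2 * (\<Sum>n<N. X n x * X N x) + X N x * X N x))"
      by (intro Bochner_Integration.integral_cong)
        (auto simp: S_def power2_eq_square sum_distrib_right sum_distrib_left algebra_simps)
    also have "\<dots> = expectation (\<lambda>x. (S N x)\<^sup>2)
        + (2 * (\<Sum>n<N. expectation (\<lambda>x. X n x * X N x)) + expectation (\<lambda>x. X N x * X N x))"
      using intX intS by simp
    \<comment> \<open>The diagonal term is counted twice so that it joins the cross terms in a
      single sum over \<open>n < Suc N\<close>.\<close>
    also have "\<dots> \<le> expectation (\<lambda>x. (S N x)\<^sup>2)
        + (2 * (\<Sum>n<N. C / real (Suc (N - n))) + 2 * (C / real (Suc (N - N))))"
    proof -
      have "(\<Sum>n<N. expectation (\<lambda>x. X n x * X N x)) \<le> (\<Sum>n<N. C / real (Suc (N - n)))"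
        using corr by (intro sum_mono) (auto simp: abs_le_iff)
      moreover have "expectation (\<lambda>x. X N x * X N x) \<le> C / real (Suc (N - N))"
        using corr[of N N] by (simp add: abs_le_iff)
      ultimately show ?thesis using \<open>0 \<le> C\<close> by simp
    qed
    also have "2 * (\<Sum>n<N. C / real (Suc (N - n))) + 2 * (C / real (Suc (N - N)))
        = 2 * C * (\<Sum>n<Suc N. 1 / real (Suc (N - n)))"
      by (simp add: sum_distrib_left algebra_simps)
    also have "(\<Sum>n<Suc N. 1 / real (Suc (N - n))) = (\<Sum>r<Suc N. 1 / real (Suc r))"
      using sum.nat_diff_reindex[of "\<lambda>r. 1 / real (Suc r)" "Suc N"] by simp
    also have "2 * C * (\<Sum>r<Suc N. 1 / real (Suc r)) \<le> 2 * C * (2 * sqrt (real (Suc N)))"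
      using \<open>0 \<le> C\<close> sum_inverse_le_sqrt[of "Suc N"] by (intro mult_left_mono) auto
    also have "expectation (\<lambda>x. (S N x)\<^sup>2) + 2 * C * (2 * sqrt (real (Suc N)))
        \<le> 4 * C * (real N * sqrt (real N)) + 2 * C * (2 * sqrt (real (Suc N)))"
      using Suc by simp
    also have "\<dots> = 4 * C * (real N * sqrt (real N) + sqrt (real (Suc N)))"
      by (simp add: algebra_simps)
    also have "\<dots> \<le> 4 * C * (real (Suc N) * sqrt (real (Suc N)))"
    proof -
      have "real N * sqrt (real N) \<le> real N * sqrt (real (Suc N))" by (intro mult_left_mono) auto
      then show ?thesis using \<open>0 \<le> C\<close> by (intro mult_left_mono) (auto simp: algebra_simps)
    qed
    finally show ?case by simp
  qed
  define Y where "Y j x = (S (Suc j ^ 4) x / real (Suc j ^ 4))\<^sup>2" for j x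
  have "AE x in M. (\<lambda>j. Y j x) \<longlonglongrightarrow> 0"
  proof (rule AE_tendsto_zero_if_summable_integrals)
    show "Y j \<in> borel_measurable M" for j unfolding Y_def by measurable
    show "0 \<le> Y j x" for j x by (simp add: Y_def)
    show "integrable M (Y j)" for j
      unfolding Y_def power_divide using intS by simp
    show "expectation (Y j) \<le> 4 * C * (1 / real (Suc j) ^ 2)" for j
    proof -
      let ?t = "real (Suc j)"
      have t: "sqrt (real (Suc j ^ 4)) = ?t ^ 2"
        by (rule real_sqrt_unique) (auto simp flip: power_mult)
      have "expectation (Y j) = expectation (\<lambda>x. (S (Suc j ^ 4) x)\<^sup>2) / ?t ^ 8"
        unfolding Y_def power_divide by (simp flip: power_mult)
      also have "\<dots> \<le> (4 * C * (real (Suc j ^ 4) * sqrt (real (Suc j ^ 4)))) / ?t ^ 8"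
        by (intro divide_right_mono ES) auto
      also have "\<dots> = 4 * C * (?t ^ 6 / ?t ^ 8)"
        unfolding t by (simp flip: power_add)
      also have "?t ^ 6 / ?t ^ 8 = 1 / ?t ^ 2"
        using power_add[of ?t 6 2] by (simp add: field_simps del: of_nat_Suc)
      finally show ?thesis .
    qed
    have "summable (\<lambda>j. inverse (real (Suc j) ^ 2))"
      by (subst summable_Suc_iff) (rule inverse_power_summable, simp)
    then show "summable (\<lambda>j. 4 * C * (1 / real (Suc j) ^ 2))"
      by (intro summable_mult) (simp add: divide_inverse)
  qed
  then show ?thesis
  proof (rule AE_mp, intro AE_I2 impI)
    fix x assume "(\<lambda>j. Y j x) \<longlonglongrightarrow> 0"
    then have "(\<lambda>j. sqrt (Y j x)) \<longlonglongrightarrow> sqrt 0" by (rule tendsto_real_sqrt)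
    then have "(\<lambda>j. \<bar>S (Suc j ^ 4) x / real (Suc j ^ 4)\<bar>) \<longlonglongrightarrow> 0" by (simp add: Y_def)
    then have "(\<lambda>j. (\<Sum>n<Suc j ^ 4. X n x) / real (Suc j ^ 4)) \<longlonglongrightarrow> 0"
      unfolding S_def by (rule tendsto_rabs_zero_cancel)
    then show "(\<lambda>N. (\<Sum>n<N. X n x) / real N) \<longlonglongrightarrow> 0"
      using bd by (intro average_tendsto_zero_if_subsequence)
  qed
qed

text \<open>Garsia's argument.\<close>

lemma (in prob_space) maximal_ergodic:
  fixes f :: "'a \<Rightarrow> real"
  assumes T [measurable]: "T \<in> measurable M M" and pres: "distr M M T = M"
    and [measurable]: "f \<in> borel_measurable M" and bd: "\<And>x. \<bar>f x\<bar> \<le> B"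
  defines "m \<equiv> \<lambda>N x. Max ((\<lambda>k. \<Sum>n<k. f ((T ^^ n) x)) ` {..N})"
  shows "0 \<le> expectation (\<lambda>x. f x * indicator {x \<in> space M. 0 < m N x} x)"
proof -
  have Tn [measurable]: "(T ^^ n) \<in> measurable M M" for n by (induction n) auto
  have [measurable]: "m N \<in> borel_measurable M" unfolding m_def by measurable
  have m0: "0 \<le> m N x" for x unfolding m_def by (rule Max_ge) (auto intro!: image_eqI[of _ _ 0])
  have mbd: "m N x \<le> real N * B" for x
  proof -
    have "(\<Sum>n<k. f ((T ^^ n) x)) \<le> real N * B" if "k \<le> N" for k
    proof -
      have "0 \<le> B" using bd[of x] by linarith
      have "(\<Sum>n<k. f ((T ^^ n) x)) \<le> (\<Sum>n<k. B)" using bd by (intro sum_mono) (auto simp: abs_le_iff)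
      also have "\<dots> \<le> real N * B" using that \<open>0 \<le> B\<close> by (simp add: mult_right_mono)
      finally show ?thesis .
    qed
    then show ?thesis unfolding m_def by (intro Max.boundedI) auto
  qed
  have int: "integrable M (m N)"
    using m0 mbd by (intro integrable_const_bound[where B="real N * B"]) auto
  have intT: "integrable M (\<lambda>x. m N (T x))"
    using m0 mbd by (intro integrable_const_bound[where B="real N * B"]) auto
  have intf: "integrable M (\<lambda>x. f x * indicator {x \<in> space M. 0 < m N x} x)"
    using bd by (intro integrable_const_bound[where B=B]) (auto simp: abs_mult indicator_def intro: order_trans[OF abs_ge_zero bd])
  \<comment> \<open>Where the maximum is positive, it is attained at some \<open>k > 0\<close>;
    splitting off the summand \<open>f x\<close> leaves a partial sum along the orbit of
    \<open>T x\<close>. Elsewhere the maximum is \<open>0\<close>, since the empty sum competes, and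
    \<open>m N (T x)\<close> is nonnegative. By invariance the left side has integral zero.\<close>
  have key: "m N x - m N (T x) \<le> f x * indicator {x \<in> space M. 0 < m N x} x" if "x \<in> space M" for x
  proof (cases "0 < m N x")
    case True
    have "m N x \<in> (\<lambda>k. \<Sum>n<k. f ((T ^^ n) x)) ` {..N}" unfolding m_def by (rule Max_in) auto
    then obtain k where k: "k \<le> N" "m N x = (\<Sum>n<k. f ((T ^^ n) x))" by auto
    with True obtain j where j: "k = Suc j" by (cases k) auto
    have "m N x = f x + (\<Sum>n<j. f ((T ^^ n) (T x)))"
      unfolding k j by (simp add: sum.lessThan_Suc_shift funpow_swap1 del: sum.lessThan_Suc)
    moreover have "(\<Sum>n<j. f ((T ^^ n) (T x))) \<le> m N (T x)"
      unfolding m_def using j k by (intro Max_ge) auto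
    ultimately show ?thesis using True that by simp
  next
    case False
    then show ?thesis using m0[of "T x"] m0[of x] by simp
  qed
  have "expectation (\<lambda>x. m N (T x)) = expectation (m N)"
    using integral_distr[of T M M "m N"] by (simp add: pres)
  then have "0 = expectation (\<lambda>x. m N x - m N (T x))" using int intT by simp
  also have "\<dots> \<le> expectation (\<lambda>x. f x * indicator {x \<in> space M. 0 < m N x} x)"
    using int intT intf key by (intro integral_mono_AE) auto
  finally show ?thesis .
qed

text \<open>The maximal inequality for \<open>indicator D - a\<close>: an orbit visits
  \<open>D\<close> with frequency above \<open>a\<close> at some time exactly when some partial sum
  of this function is positive. One exceptional set serves all \<open>N\<close> at once.\<close>

lemma (in prob_space) maximal_inequality_indicator:
  assumes T [measurable]: "T \<in> measurable M M" and pres: "distr M M T = M"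
    and [measurable]: "D \<in> sets M" and a: "0 < a"
  defines "U \<equiv> {x \<in> space M. \<exists>N. a * real N < (\<Sum>n<N. indicator D ((T ^^ n) x))}"
  shows "U \<in> sets M" "prob U \<le> prob D / a"
proof -
  have Tn [measurable]: "(T ^^ n) \<in> measurable M M" for n by (induction n) auto
  show U [measurable]: "U \<in> sets M" unfolding U_def by measurable
  define f where "f x = indicator D x - a" for x :: 'a
  have [measurable]: "f \<in> borel_measurable M" unfolding f_def by measurable
  define m where "m N x = Max ((\<lambda>k. \<Sum>n<k. f ((T ^^ n) x)) ` {..N})" for N x
  have [measurable]: "m N \<in> borel_measurable M" for N unfolding m_def by measurable
  define V where "V N = {x \<in> space M. 0 < m N x}" for N
  have V [measurable]: "V N \<in> sets M" for N unfolding V_def by measurable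
  have sumf: "(\<Sum>n<k. f ((T ^^ n) x)) = (\<Sum>n<k. indicator D ((T ^^ n) x)) - a * real k" for k x
    by (simp add: f_def sum_subtractf)
  have UV: "U = (\<Union>N. V N)"
    unfolding U_def V_def m_def by (auto simp: Max_gr_iff sumf)
  have inc: "incseq V"
    unfolding V_def m_def by (auto simp: incseq_def Max_gr_iff intro: order_trans)
  have "a * prob (V N) \<le> prob D" for N
  proof -
    have "\<bar>f x\<bar> \<le> 1 + a" for x using a by (auto simp: f_def indicator_def)
    from maximal_ergodic[OF T pres \<open>f \<in> borel_measurable M\<close> this, of N]
    have "0 \<le> expectation (\<lambda>x. f x * indicator (V N) x)" by (simp add: V_def m_def)
    also have "\<dots> = expectation (\<lambda>x. indicator (D \<inter> V N) x - a * indicator (V N) x)"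
      by (intro Bochner_Integration.integral_cong) (auto simp: f_def indicator_def)
    also have "\<dots> = prob (D \<inter> V N) - a * prob (V N)"
      by (subst Bochner_Integration.integral_diff) (auto simp: emeasure_eq_measure)
    also have "prob (D \<inter> V N) \<le> prob D" by (intro finite_measure_mono) auto
    finally show ?thesis by simp
  qed
  then have "prob (V N) \<le> prob D / a" for N using a by (simp add: field_simps)
  then show "prob U \<le> prob D / a"
    unfolding UV using V inc by (intro LIMSEQ_le_const2[OF finite_Lim_measure_incseq]) auto
qed

section \<open>Itineraries\<close>


lemma space_leb01 [simp]: "space leb01 = {0..1}"
  by (simp add: leb01_def space_restrict_space)

lemma sets_leb01: "sets leb01 = sets (restrict_space borel {0..1})"
  unfolding leb01_def by (rule sets_restrict_space_cong) simp

lemma sets_leb01_iff: "A \<in> sets leb01 \<longleftrightarrow> A \<in> sets borel \<and> A \<subseteq> {0..1}"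
  by (auto simp: sets_leb01 sets_restrict_space_iff)

lemma emeasure_leb01: "A \<in> sets leb01 \<Longrightarrow> emeasure leb01 A = emeasure lborel A"
  by (auto simp: leb01_def emeasure_restrict_space sets_restrict_space_iff)

interpretation leb01: prob_space leb01
  by (rule prob_spaceI) (simp add: leb01_def emeasure_restrict_space space_restrict_space)

lemma finite_null_leb01: "finite F \<Longrightarrow> F \<subseteq> {0..1} \<Longrightarrow> F \<in> null_sets leb01"
  by (intro null_setsI) (auto simp: emeasure_leb01 sets_leb01_iff finite_imp_closed borel_closed emeasure_lborel_countable countable_finite)

lemma interval_diff_interior:
  fixes I :: "real set"
  assumes "is_interval I" "I \<subseteq> {0..1}"
  shows "I - interior I \<subseteq> {Inf I, Sup I}"
proof
  fix x assume x: "x \<in> I - interior I"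
  have bdd: "bdd_below I" "bdd_above I" using assms(2) by (auto intro: bdd_below_mono bdd_above_mono)
  show "x \<in> {Inf I, Sup I}"
  proof (rule ccontr)
    assume "x \<notin> {Inf I, Sup I}"
    then have "Inf I < x" "x < Sup I" using x bdd
      by (auto simp: less_le intro: cInf_lower cSup_upper)
    then obtain a b where ab: "a \<in> I" "a < x" "b \<in> I" "x < b"
      using x bdd cInf_less_iff[of I x] less_cSup_iff[of I x] by blast
    then have "{a<..<b} \<subseteq> I"
      using assms(1) unfolding is_interval_1 by (meson greaterThanLessThan_iff less_imp_le subsetI)
    then have "x \<in> interior I" using ab by (intro interiorI[of "{a<..<b}"]) auto
    then show False using x by simp
  qed
qed

lemma interval_null_sets:
  assumes "is_interval I" "I \<subseteq> {0..1}"
  shows "I - interior I \<in> null_sets leb01" "I \<in> sets leb01"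
proof -
  have "finite (I - interior I)" by (rule finite_subset[OF interval_diff_interior[OF assms]]) simp
  then show null: "I - interior I \<in> null_sets leb01"
    using assms(2) by (intro finite_null_leb01) auto
  have "interior I \<in> sets leb01"
    using assms(2) interior_subset[of I] by (auto simp: sets_leb01_iff)
  with null have "interior I \<union> (I - interior I) \<in> sets leb01" by blast
  moreover have "interior I \<union> (I - interior I) = I" using interior_subset by blast
  ultimately show "I \<in> sets leb01" by simp
qed

declare atLeastAtMost_iff [simp del]

section \<open>A single system: comparison with Lebesgue measure, iterates, words\<close>

locale interval_system =
  fixes T :: "real \<Rightarrow> real" and \<mu> :: "real measure" and P :: "real set set"
  assumes class_T: "class_T T \<mu> P"
    and property_E: "property_E T \<mu> P"
    and property_M: "property_M T \<mu> P"
begin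

lemma sets_mu: "sets \<mu> = sets leb01"
  using class_T by (simp add: class_T_def sets_leb01)

lemma space_mu: "space \<mu> = {0..1}"
  using sets_eq_imp_space_eq[OF sets_mu] by simp

sublocale \<mu>: prob_space \<mu>
  using class_T by (simp add: class_T_def)

lemma comparable:
  obtains c where "1 \<le> c" "\<And>A. A \<in> sets leb01 \<Longrightarrow> measure leb01 A \<le> c * measure \<mu> A"
    "\<And>A. A \<in> sets leb01 \<Longrightarrow> measure \<mu> A \<le> c * measure leb01 A"
proof -
  from class_T obtain c where c: "1 \<le> c" "\<And>A. A \<in> sets leb01 \<Longrightarrow>
      1 / c * measure \<mu> A \<le> measure leb01 A \<and> measure leb01 A \<le> c * measure \<mu> A"
    unfolding class_T_def sets_mu by blast
  show thesis
  proof (rule that[of c])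
    show "measure \<mu> A \<le> c * measure leb01 A" if "A \<in> sets leb01" for A
      using c(1) c(2)[OF that] by (simp add: field_simps)
  qed (use c in auto)
qed

lemma null_sets_mu: "null_sets \<mu> = null_sets leb01"
proof -
  obtain c where c: "1 \<le> c" "\<And>A. A \<in> sets leb01 \<Longrightarrow> measure leb01 A \<le> c * measure \<mu> A"
    "\<And>A. A \<in> sets leb01 \<Longrightarrow> measure \<mu> A \<le> c * measure leb01 A" using comparable by blast
  have "measure leb01 A = 0 \<longleftrightarrow> measure \<mu> A = 0" if "A \<in> sets leb01" for A
    using c(2,3)[OF that] measure_nonneg[of leb01 A] measure_nonneg[of \<mu> A]
    by (metis antisym mult_zero_right)
  then show ?thesis
    by (auto simp: null_sets_def sets_mu \<mu>.emeasure_eq_measure leb01.emeasure_eq_measure)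
qed

text \<open>The invariant measures vary with the system, so Lebesgue measure serves as the common
  reference for almost-everywhere statements.\<close>

lemma AE_mu_iff: "(AE x in \<mu>. Q x) \<longleftrightarrow> (AE x in leb01. Q x)"
proof -
  have "ae_filter \<mu> = ae_filter leb01" by (simp add: ae_filter_def null_sets_mu space_mu)
  then show ?thesis by (simp only:)
qed

lemma measurable_T [measurable]: "T \<in> measurable leb01 leb01"
  using class_T measurable_cong_sets[OF sets_mu sets_mu]
  by (auto simp: class_T_def measure_preserving_map_def)

lemma measurable_iterate [measurable]: "(T ^^ n) \<in> measurable leb01 leb01"
  by (induction n) auto

lemma T_iterate_in: "x \<in> {0..1} \<Longrightarrow> (T ^^ n) x \<in> {0..1}"
  using measurable_space[OF measurable_iterate] by simp

lemma vimage_iterate_sets: "B \<in> sets leb01 \<Longrightarrow> (T ^^ n) -` B \<inter> {0..1} \<in> sets leb01"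
  using measurable_sets[OF measurable_iterate] by simp

lemma distr_T: "distr \<mu> \<mu> T = \<mu>"
  using class_T by (simp add: class_T_def measure_preserving_map_def)

lemma measure_vimage_iterate:
  assumes "B \<in> sets leb01"
  shows "measure \<mu> ((T ^^ n) -` B \<inter> {0..1}) = measure \<mu> B"
proof (induction n)
  case 0
  have "B \<inter> {0..1} = B" using sets.sets_into_space[OF assms] by auto
  then show ?case by simp
next
  case (Suc n)
  let ?C = "(T ^^ n) -` B \<inter> {0..1}"
  have eq: "(T ^^ Suc n) -` B \<inter> {0..1} = T -` ?C \<inter> space \<mu>"
    using T_iterate_in[of _ 1] by (auto simp: space_mu funpow_swap1)
  have "measure \<mu> (T -` ?C \<inter> space \<mu>) = measure (distr \<mu> \<mu> T) ?C"
    using vimage_iterate_sets[OF assms, of n]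
    by (intro measure_distr[symmetric]) (auto simp: sets_mu measurable_cong_sets[OF sets_mu sets_mu])
  then show ?case using Suc unfolding eq distr_T by simp
qed

text \<open>Lebesgue measure need not be invariant, but it has the null sets of \<mu>, and preimages
  of \<mu>-null sets are \<mu>-null.\<close>

lemma AE_iterate:
  assumes "AE x in leb01. Q x"
  shows "AE x in leb01. Q ((T ^^ n) x)"
proof -
  from assms obtain N where N: "N \<in> null_sets leb01" "{x \<in> {0..1}. \<not> Q x} \<subseteq> N"
    by (auto elim!: AE_E simp: null_sets_def)
  have "measure \<mu> ((T ^^ n) -` N \<inter> {0..1}) = 0"
    using N measure_vimage_iterate[of N n] by (auto simp: null_sets_mu[symmetric] measure_eq_0_null_sets sets_mu)
  then have "(T ^^ n) -` N \<inter> {0..1} \<in> null_sets leb01"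
    using N(1) vimage_iterate_sets[of N n] unfolding null_sets_mu[symmetric]
    by (auto simp: null_sets_def sets_mu \<mu>.emeasure_eq_measure)
  then show ?thesis
    by (rule AE_I') (use N T_iterate_in in auto)
qed

lemma interval_partition: "interval_partition P" and countable_P: "countable P"
  using class_T by (auto simp: class_T_def interval_partition_def)

lemma interval_P: "I \<in> P \<Longrightarrow> is_interval I" "I \<in> P \<Longrightarrow> I \<subseteq> {0..1}"
  "I \<in> P \<Longrightarrow> interior I \<noteq> {}"
  using interval_partition by (auto simp: interval_partition_def)

lemma P_sets: "I \<in> P \<Longrightarrow> I \<in> sets leb01"
  by (intro interval_null_sets(2) interval_P)

lemma interior_P_unique: "I \<in> P \<Longrightarrow> J \<in> P \<Longrightarrow> x \<in> interior I \<Longrightarrow> x \<in> interior J \<Longrightarrow> I = J"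
  using interval_partition unfolding interval_partition_def disjoint_family_on_def by blast

text \<open>Orbit points outside the interiors of the partition intervals get the letter \<open>{}\<close>, which
  does not belong to \<open>P\<close>. Thus words are defined everywhere, and sets of words correspond to sets of
  points exactly, not only up to null sets.\<close>

definition symb :: "real \<Rightarrow> real set" where
  "symb x = (if \<exists>I\<in>P. x \<in> interior I then THE I. I \<in> P \<and> x \<in> interior I else {})"

definition wd :: "nat \<Rightarrow> real \<Rightarrow> real set list" where
  "wd n x = map (\<lambda>j. symb ((T ^^ j) x)) [0..<n]"

definition fib :: "nat \<Rightarrow> real \<Rightarrow> real set" where
  "fib n x = {y \<in> {0..1}. wd n y = wd n x}"

text \<open>The set \<open>W\<close> of words is arbitrary, so \<open>cyl n\<close> is closed under
  complements and arbitrary unions. Measurability survives because only countably many words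
  occur.\<close>

definition cyl :: "nat \<Rightarrow> real set set" where
  "cyl n = {{x \<in> {0..1}. wd n x \<in> W} | W. True}"

lemma symb_eq: "I \<in> P \<Longrightarrow> x \<in> interior I \<Longrightarrow> symb x = I"
  unfolding symb_def using interior_P_unique by (auto intro!: the_equality)

lemma symb_cases: "symb x \<in> P \<and> x \<in> interior (symb x) \<or> symb x = {} \<and> (\<forall>I\<in>P. x \<notin> interior I)"
  using symb_eq by (metis symb_def)

lemma empty_notin_P: "{} \<notin> P"
  using interval_P(3) by fastforce

lemma symb_eq_iff: "I \<in> P \<Longrightarrow> symb x = I \<longleftrightarrow> x \<in> interior I"
  using symb_eq[of I x] symb_cases[of x] empty_notin_P by auto

lemma symb_empty_iff: "symb x = {} \<longleftrightarrow> x \<notin> (\<Union>I\<in>P. interior I)"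
  using symb_cases[of x] symb_eq[of _ x] empty_notin_P by auto

lemma interior_P_subset: "I \<in> P \<Longrightarrow> interior I \<subseteq> {0..1}"
  using interval_P(2)[of I] interior_subset[of I] by (rule order_trans[rotated])

lemma length_wd [simp]: "length (wd n x) = n"
  by (simp add: wd_def)

lemma nth_wd [simp]: "j < n \<Longrightarrow> wd n x ! j = symb ((T ^^ j) x)"
  by (simp add: wd_def)

lemma take_wd: "take l (wd (l + k) x) = wd l x"
  by (rule nth_equalityI) auto

lemma drop_wd: "drop n (wd (n + l) x) = wd l ((T ^^ n) x)"
  by (rule nth_equalityI) (auto simp: funpow_add add.commute)

lemma set_wd: "set (wd n x) \<subseteq> insert {} P"
  using symb_cases by (auto simp: wd_def)

lemma wd_eq_iff: "wd n y = v \<longleftrightarrow> length v = n \<and> (\<forall>j<n. symb ((T ^^ j) y) = v ! j)"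
  by (auto simp: list_eq_iff_nth_eq)

lemma sets_symb [measurable]: "{x \<in> {0..1}. symb x = v} \<in> sets leb01"
proof -
  have int: "I \<in> P \<Longrightarrow> interior I \<in> sets leb01" for I
    using interior_P_subset[of I] by (simp add: sets_leb01_iff)
  show ?thesis
  proof (cases "v \<in> P")
    case True
    then have "{x \<in> {0..1}. symb x = v} = interior v"
      using interior_P_subset[OF True] by (auto simp: symb_eq_iff)
    then show ?thesis using int True by simp
  next
    case notin: False
    show ?thesis
    proof (cases "v = {}")
      case True
      then have "{x \<in> {0..1}. symb x = v} = {0..1} - (\<Union>I\<in>P. interior I)"
        by (auto simp: symb_empty_iff)
      moreover have "(\<Union>I\<in>P. interior I) \<in> sets leb01"
        using int countable_P by (intro sets.countable_UN') auto
      ultimately show ?thesis using sets.compl_sets[of _ leb01] by simp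
    next
      case False
      then have "{x \<in> {0..1}. symb x = v} = {}" using symb_cases notin by auto
      then show ?thesis by (simp only: sets.empty_sets)
    qed
  qed
qed

lemma cylI: "{x \<in> {0..1}. wd n x \<in> W} \<in> cyl n" "{x \<in> {0..1}. Q (wd n x)} \<in> cyl n"
  unfolding cyl_def by (auto intro: exI[of _ "{w. Q w}"])

lemma cylE:
  assumes "C \<in> cyl n" obtains W where "C = {x \<in> {0..1}. wd n x \<in> W}"
  using assms by (auto simp: cyl_def)

lemma sets_wd: "{x \<in> {0..1}. wd n x \<in> W} \<in> sets leb01"
proof -
  have *: "{x \<in> {0..1}. wd n x = v} \<in> sets leb01" for v
  proof (cases "length v = n")
    case True
    have "{x \<in> {0..1}. wd n x = v}
        = {0..1} \<inter> (\<Inter>j\<in>{..<n}. (T ^^ j) -` {x \<in> {0..1}. symb x = v ! j} \<inter> {0..1})"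
      using True T_iterate_in by (auto simp: wd_eq_iff)
    also have "\<dots> \<in> sets leb01"
    proof (cases "n = 0")
      case True
      then show ?thesis using sets.top[of leb01] by simp
    next
      case False
      then have "(\<Inter>j\<in>{..<n}. (T ^^ j) -` {x \<in> {0..1}. symb x = v ! j} \<inter> {0..1}) \<in> sets leb01"
        by (intro sets.finite_INT vimage_iterate_sets sets_symb) auto
      then show ?thesis using sets.top[of leb01] by auto
    qed
    finally show ?thesis .
  next
    case False
    then have "{x \<in> {0..1}. wd n x = v} = {}" by auto
    then show ?thesis by (simp only: sets.empty_sets)
  qed
  have "{x \<in> {0..1}. wd n x \<in> W} = (\<Union>v\<in>W \<inter> lists (insert {} P). {x \<in> {0..1}. wd n x = v})"
    using set_wd by (auto simp: lists_eq_set)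
  moreover have "countable (W \<inter> lists (insert {} P))"
    using countable_P by (intro countable_Int2 countable_lists) auto
  ultimately show ?thesis using * by (metis (no_types, lifting) sets.countable_UN'')
qed

lemma cyl_sets: "C \<in> cyl n \<Longrightarrow> C \<in> sets leb01"
  by (elim cylE) (simp add: sets_wd)

lemma fib_sets: "fib n x \<in> sets leb01"
  using sets_wd[of n "{wd n x}"] by (simp add: fib_def)

lemma cyl_mono: "C \<in> cyl l \<Longrightarrow> l \<le> m \<Longrightarrow> C \<in> cyl m"
proof (elim cylE)
  fix W assume C: "C = {x \<in> {0..1}. wd l x \<in> W}" and "l \<le> m"
  then obtain k where "m = l + k" by (auto simp: le_iff_add)
  then have "C = {x \<in> {0..1}. take l (wd m x) \<in> W}" unfolding C by (simp only: take_wd)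
  then show ?thesis using cylI(2) by simp
qed

lemma cyl_vimage: "C \<in> cyl l \<Longrightarrow> (T ^^ n) -` C \<inter> {0..1} \<in> cyl (n + l)"
proof (elim cylE)
  fix W assume C: "C = {x \<in> {0..1}. wd l x \<in> W}"
  have "(T ^^ n) -` C \<inter> {0..1} = {x \<in> {0..1}. drop n (wd (n + l) x) \<in> W}"
    unfolding C drop_wd using T_iterate_in by auto
  then show "(T ^^ n) -` C \<inter> {0..1} \<in> cyl (n + l)" using cylI(2) by simp
qed

lemma cyl_Int: "A \<in> cyl n \<Longrightarrow> B \<in> cyl n \<Longrightarrow> A \<inter> B \<in> cyl n"
proof (elim cylE)
  fix V W assume "A = {x \<in> {0..1}. wd n x \<in> V}" "B = {x \<in> {0..1}. wd n x \<in> W}"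
  then have "A \<inter> B = {x \<in> {0..1}. wd n x \<in> V \<inter> W}" by auto
  then show ?thesis using cylI(1) by (simp only:)
qed

lemma cyl_top: "{0..1} \<in> cyl n"
  using cylI(1)[of n UNIV] by simp

lemma cyl_compl: "A \<in> cyl n \<Longrightarrow> {0..1} - A \<in> cyl n"
proof (elim cylE)
  fix V assume "A = {x \<in> {0..1}. wd n x \<in> V}"
  then have "{0..1} - A = {x \<in> {0..1}. wd n x \<in> - V}" by auto
  then show ?thesis using cylI(1) by (simp only:)
qed

lemma cyl_UN:
  assumes "\<And>i. i \<in> I \<Longrightarrow> A i \<in> cyl n"
  shows "(\<Union>i\<in>I. A i) \<in> cyl n"
proof -
  have "\<forall>i\<in>I. \<exists>V. A i = {x \<in> {0..1}. wd n x \<in> V}" using assms unfolding cyl_def by blast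
  from bchoice[OF this] obtain V where "\<forall>i\<in>I. A i = {x \<in> {0..1}. wd n x \<in> V i}" ..
  then have "(\<Union>i\<in>I. A i) = {x \<in> {0..1}. wd n x \<in> (\<Union>i\<in>I. V i)}" by auto
  then show ?thesis using cylI(1) by (simp only:)
qed

text \<open>At such points the intervals themselves, which may overlap in end points, and the
  letters read from their interiors agree along the whole orbit.\<close>

definition regular :: "real \<Rightarrow> bool" where
  "regular x \<longleftrightarrow> (\<forall>n. symb ((T ^^ n) x) \<in> P \<and> (\<forall>I\<in>P. (T ^^ n) x \<in> I \<longleftrightarrow> symb ((T ^^ n) x) = I))"

text \<open>Only countably many null sets are discarded: the points outside
  \<open>\<Union>P\<close>, the end points of each interval, and the preimages of these under all
  iterates.\<close>

lemma AE_regular: "AE x in leb01. regular x"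
proof -
  have "AE x in leb01. x \<in> \<Union>P"
    by (rule AE_I'[of "{0..1} - \<Union>P"]) (use interval_partition in \<open>auto simp: interval_partition_def\<close>)
  moreover have "AE x in leb01. \<forall>I\<in>P. x \<notin> I - interior I"
    using interval_null_sets(1)[OF interval_P(1,2)] by (subst AE_ball_countable[OF countable_P]) (intro ballI AE_not_in; blast)
  ultimately have "AE x in leb01. symb x \<in> P \<and> (\<forall>I\<in>P. x \<in> I \<longleftrightarrow> symb x = I)"
  proof eventually_elim
    case (elim x)
    then obtain I where "I \<in> P" "x \<in> interior I" by blast
    moreover have "x \<in> J \<longleftrightarrow> symb x = J" if "J \<in> P" for J
      using elim that symb_eq[of J x] symb_cases[of x] interior_subset by blast
    ultimately show ?case using symb_eq by auto
  qed
  then have "AE x in leb01. symb ((T ^^ n) x) \<in> P \<and> (\<forall>I\<in>P. (T ^^ n) x \<in> I \<longleftrightarrow> symb ((T ^^ n) x) = I)" for n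
    by (rule AE_iterate)
  then show ?thesis unfolding regular_def by (simp add: AE_all_countable)
qed

lemma regular_wd: "regular x \<Longrightarrow> set (wd n x) \<subseteq> P"
  by (auto simp: regular_def wd_def)

text \<open>Peeling off the first letter exhibits the fibre as the preimage of a shorter one under a
  monotone branch, and monotone maps pull intervals back to intervals. The hypothesis excludes the
  letter \<open>{}\<close>, whose points need not form an interval.\<close>

lemma is_interval_fib:
  assumes "set (wd n x) \<subseteq> P"
  shows "is_interval (fib n x)"
proof -
  have "is_interval {y \<in> {0..1}. \<forall>j<n. symb ((T ^^ j) y) = v ! j}" if "set v \<subseteq> P" "length v = n" for v
    using that
  proof (induction n arbitrary: v)
    case 0
    then show ?case by (simp add: is_interval_cc)
  next
    case (Suc n)
    then obtain I w where v: "v = I # w" by (cases v) auto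
    with Suc have I: "I \<in> P" "set w \<subseteq> P" "length w = n" by auto
    let ?J = "{y \<in> {0..1}. \<forall>j<n. symb ((T ^^ j) y) = w ! j}"
    have J: "is_interval ?J" using Suc.IH I by blast
    have eq: "{y \<in> {0..1}. \<forall>j<Suc n. symb ((T ^^ j) y) = v ! j} = {y \<in> interior I. T y \<in> ?J}"
    proof -
      have "y \<in> {0..1} \<Longrightarrow> T y \<in> {0..1}" for y using T_iterate_in[of y 1] by simp
      then show ?thesis
        using interior_P_subset[OF I(1)] symb_eq_iff[OF I(1)] unfolding v
        by (auto simp: All_less_Suc2 funpow_swap1)
    qed
    have mono: "strict_mono_on (interior I) T \<or> strict_antimono_on (interior I) T"
      using class_T I(1) by (auto simp: class_T_def)
    have int: "is_interval (interior I)"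
      using interval_P(1)[OF I(1)] by (simp add: is_interval_convex_1 convex_interior)
    show ?case unfolding eq is_interval_1
    proof (intro ballI allI impI)
      fix a b y assume a: "a \<in> {y \<in> interior I. T y \<in> ?J}" and b: "b \<in> {y \<in> interior I. T y \<in> ?J}"
        and y: "a \<le> y \<and> y \<le> b"
      then have yI: "y \<in> interior I" using int unfolding is_interval_1 by blast
      have "T a \<le> T y \<and> T y \<le> T b \<or> T b \<le> T y \<and> T y \<le> T a"
        using mono a b y yI by (auto simp: monotone_on_def le_less)
      then have "T y \<in> ?J" using a b J unfolding is_interval_1 by blast
      then show "y \<in> {y \<in> interior I. T y \<in> ?J}" using yI by simp
    qed
  qed
  from this[OF assms] show ?thesis by (simp add: fib_def wd_eq_iff)
qed

end

section \<open>Mixing, generation and entropy in terms of itineraries\<close>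


lemma (in finite_measure) measure_sym_diff_triangle:
  assumes "A \<in> sets M" "B \<in> sets M" "C \<in> sets M"
  shows "measure M (sym_diff A C) \<le> measure M (sym_diff A B) + measure M (sym_diff B C)"
proof -
  have "measure M (sym_diff A C) \<le> measure M (sym_diff A B \<union> sym_diff B C)"
    using assms by (intro finite_measure_mono) auto
  also have "\<dots> \<le> measure M (sym_diff A B) + measure M (sym_diff B C)"
    using assms by (intro measure_subadditive) (auto simp: emeasure_eq_measure)
  finally show ?thesis .
qed

lemma (in finite_measure) measure_diff_le_sym_diff:
  assumes "A \<in> sets M" "B \<in> sets M"
  shows "\<bar>measure M A - measure M B\<bar> \<le> measure M (sym_diff A B)"
proof -
  have "measure M A \<le> measure M (B \<union> sym_diff A B)" "measure M B \<le> measure M (A \<union> sym_diff A B)"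
    using assms by (auto intro!: finite_measure_mono)
  moreover have "measure M (B \<union> sym_diff A B) \<le> measure M B + measure M (sym_diff A B)"
    "measure M (A \<union> sym_diff A B) \<le> measure M A + measure M (sym_diff A B)"
    using assms by (auto intro!: measure_subadditive simp: emeasure_eq_measure)
  ultimately show ?thesis by linarith
qed

lemma (in finite_measure) measure_sym_diff_AE:
  assumes "A \<in> sets M" "B \<in> sets M" "AE x in M. x \<in> A \<longleftrightarrow> x \<in> B"
  shows "measure M (sym_diff A B) = 0"
proof -
  have "measure M (sym_diff A B) = measure M {}"
    by (rule measure_eq_AE) (use assms in auto)
  then show ?thesis by simp
qed

context interval_system begin

text \<open>Built from the partition intervals with their end points, as in
  \<open>iter_join\<close>, whereas words and fibres use interiors. The two versions agree at
  regular points.\<close>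

abbreviation atom :: "real set list \<Rightarrow> real set" where
  "atom v \<equiv> {0..1} \<inter> (\<Inter>j<length v. (T ^^ j) -` (v ! j))"

lemma regular_atom:
  assumes "regular x" "x \<in> {0..1}" "set v \<subseteq> P"
  shows "x \<in> atom v \<longleftrightarrow> wd (length v) x = v"
proof -
  have "(T ^^ j) x \<in> v ! j \<longleftrightarrow> symb ((T ^^ j) x) = v ! j" if "j < length v" for j
    using assms(1,3) nth_mem[OF that] unfolding regular_def by blast
  then show ?thesis using assms(2) by (auto simp: wd_eq_iff)
qed

lemma atom_sets:
  assumes "set v \<subseteq> P"
  shows "atom v \<in> sets leb01"
proof (cases "v = []")
  case True
  then show ?thesis using sets.top[of leb01] by simp
next
  case False
  have "(\<Inter>j\<in>{..<length v}. (T ^^ j) -` (v ! j) \<inter> {0..1}) \<in> sets leb01"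
    using False assms nth_mem[of _ v]
    by (intro sets.finite_INT vimage_iterate_sets P_sets) auto
  moreover have "(\<Inter>j\<in>{..<length v}. (T ^^ j) -` (v ! j) \<inter> {0..1}) = atom v"
    using False by auto
  ultimately show ?thesis by simp
qed

lemma atom_iter_join:
  assumes "set v \<subseteq> P" "atom v \<noteq> {}"
  shows "atom v \<in> iter_join {0..1} T P (length v)"
  unfolding iter_join_def using assms nth_mem[of _ v] by (auto intro!: exI[of _ "nth v"])

lemma iter_join_atom:
  assumes "A \<in> iter_join {0..1} T P n"
  obtains v where "set v \<subseteq> P" "length v = n" "A = atom v"
proof -
  from assms obtain a where a: "A = {0..1} \<inter> (\<Inter>j<n. (T ^^ j) -` a j)" "\<forall>j<n. a j \<in> P"
    unfolding iter_join_def by blast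
  show thesis
    by (rule that[of "map a [0..<n]"]) (use a in \<open>auto\<close>)
qed

text \<open>This carries property M, which speaks of the \<sigma>-algebra of the refined partition,
  over to sets of words. Almost every point is regular, and the countably many words over
  \<open>P\<close> account for all regular points.\<close>

lemma cyl_sigma_sets:
  assumes "C \<in> cyl n"
  obtains A where "A \<in> sigma_sets {0..1} (iter_join {0..1} T P n)" "A \<in> sets leb01"
    "AE x in leb01. x \<in> A \<longleftrightarrow> x \<in> C"
proof -
  from assms obtain W where C: "C = {x \<in> {0..1}. wd n x \<in> W}" by (rule cylE)
  define V where "V = W \<inter> {v. set v \<subseteq> P \<and> length v = n}"
  have "countable (lists P)" using countable_P by (rule countable_lists)
  then have V: "countable V"
    by (rule countable_subset[rotated]) (auto simp: V_def)
  have *: "atom v \<in> sigma_sets {0..1} (iter_join {0..1} T P n)" if "v \<in> V" for v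
    using atom_iter_join[of v] that by (cases "atom v = {}") (auto simp: V_def sigma_sets.Empty)
  show thesis
  proof
    show "(\<Union>v\<in>V. atom v) \<in> sigma_sets {0..1} (iter_join {0..1} T P n)"
      using V * by (intro sigma_sets_UNION) auto
    show "(\<Union>v\<in>V. atom v) \<in> sets leb01"
      using V atom_sets by (intro sets.countable_UN') (auto simp: V_def)
    show "AE x in leb01. x \<in> (\<Union>v\<in>V. atom v) \<longleftrightarrow> x \<in> C"
      using AE_regular AE_space
    proof eventually_elim
      case (elim x)
      then have x: "x \<in> {0..1}" by simp
      have "x \<in> atom v \<longleftrightarrow> wd n x = v" if "v \<in> V" for v
      proof -
        have v: "set v \<subseteq> P" "length v = n" using that by (auto simp: V_def)
        show ?thesis using regular_atom[OF elim(1) x v(1)] unfolding v(2) .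
      qed
      then have "x \<in> (\<Union>v\<in>V. atom v) \<longleftrightarrow> (\<exists>v\<in>V. wd n x = v)" by blast
      also have "\<dots> \<longleftrightarrow> x \<in> C"
        using regular_wd[OF elim(1), of n] x by (auto simp: V_def C)
      finally show ?case .
    qed
  qed
qed

text \<open>The bound in property M may be replaced by its running minimum, because the error for
  \<open>B\<close> and time \<open>n\<close> is the error for the preimage of \<open>B\<close> and an earlier time. This turns
  summability into decay of order \<open>1 / n\<close>.\<close>

lemma mixing:
  obtains K where "0 \<le> K"
    "\<And>l n A B. \<lbrakk>1 \<le> l; A \<in> cyl l; B \<in> sets leb01\<rbrakk> \<Longrightarrow>
      \<bar>measure leb01 (A \<inter> (T ^^ (n + l)) -` B) - measure leb01 A * measure \<mu> B\<bar> \<le> K / real (Suc n)"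
proof -
  from property_M obtain b :: "nat \<Rightarrow> real" where b: "\<And>n. 0 \<le> b n" "summable b"
    and M: "\<And>l n A B. \<lbrakk>1 \<le> l; A \<in> sigma_sets {0..1} (iter_join {0..1} T P l); B \<in> sets leb01\<rbrakk> \<Longrightarrow>
      \<bar>measure leb01 (A \<inter> (T ^^ (n + l)) -` B) - measure leb01 A * measure \<mu> B\<bar> \<le> b n"
    unfolding property_M_def sets_mu by blast
  have M': "\<bar>measure leb01 (A \<inter> (T ^^ (n + l)) -` B) - measure leb01 A * measure \<mu> B\<bar> \<le> b n"
    if "1 \<le> l" "A \<in> cyl l" "B \<in> sets leb01" for l n A B
  proof -
    from that(2) obtain A' where A': "A' \<in> sigma_sets {0..1} (iter_join {0..1} T P l)"
      "A' \<in> sets leb01" "AE x in leb01. x \<in> A' \<longleftrightarrow> x \<in> A" by (rule cyl_sigma_sets)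
    have A: "A \<in> sets leb01" using that(2) by (rule cyl_sets)
    have pre: "D \<inter> (T ^^ (n + l)) -` B \<in> sets leb01" if D: "D \<in> sets leb01" for D
    proof -
      have "D \<inter> (T ^^ (n + l)) -` B = D \<inter> ((T ^^ (n + l)) -` B \<inter> {0..1})"
        using sets.sets_into_space[OF D] by auto
      then show ?thesis using D vimage_iterate_sets[OF \<open>B \<in> sets leb01\<close>] by auto
    qed
    have "measure leb01 A' = measure leb01 A"
      by (rule measure_eq_AE) (use A' A in auto)
    moreover have "measure leb01 (A' \<inter> (T ^^ (n + l)) -` B) = measure leb01 (A \<inter> (T ^^ (n + l)) -` B)"
      by (rule measure_eq_AE) (use A' pre[OF A] pre[OF A'(2)] in auto)
    ultimately show ?thesis using M[OF that(1) A'(1) that(3), of n] by simp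
  qed
  show thesis
  proof (rule that[of "suminf b"])
    show "0 \<le> suminf b" using b by (intro suminf_nonneg) auto
    fix l n A B assume lAB: "1 \<le> l" "A \<in> cyl l" "B \<in> sets leb01"
    let ?d = "\<bar>measure leb01 (A \<inter> (T ^^ (n + l)) -` B) - measure leb01 A * measure \<mu> B\<bar>"
    have "?d \<le> b j" if "j \<le> n" for j
    proof -
      let ?B = "(T ^^ (n - j)) -` B \<inter> {0..1}"
      have "(T ^^ (n - j)) ((T ^^ (j + l)) x) = (T ^^ (n + l)) x" for x
        using that by (simp flip: funpow_add comp_apply[of "T ^^ (n - j)"])
      then have "A \<inter> (T ^^ (j + l)) -` ?B = A \<inter> (T ^^ (n + l)) -` B"
        using sets.sets_into_space[OF cyl_sets[OF lAB(2)]] T_iterate_in by auto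
      then show ?thesis
        using M'[OF lAB(1,2) vimage_iterate_sets[OF lAB(3)], of j "n - j"]
        by (simp add: measure_vimage_iterate[OF lAB(3)])
    qed
    \<comment> \<open>The error lies below each of \<open>b 0\<close>, ..., \<open>b n\<close>, so
      \<open>n + 1\<close> times the error is at most the sum of the whole series.\<close>
    then have "(\<Sum>j<Suc n. ?d) \<le> (\<Sum>j<Suc n. b j)" by (intro sum_mono) auto
    also have "\<dots> \<le> suminf b" using b by (intro sum_le_suminf) auto
    finally show "?d \<le> suminf b / real (Suc n)" by (simp add: field_simps)
  qed
qed

text \<open>The sets that can be approximated are closed under complements and countable unions and
  contain the preimages of \<sigma>-algebra sets of \<open>P\<close>; the generating property then
  reaches every Borel set up to a null set.\<close>

lemma cyl_dense:
  assumes "B \<in> sets leb01" "0 < e"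
  obtains l C where "1 \<le> l" "C \<in> cyl l" "measure \<mu> (sym_diff B C) < e"
proof -
  define approx where "approx B \<longleftrightarrow> B \<in> sets leb01 \<and>
    (\<forall>e>0. \<exists>l\<ge>1. \<exists>C\<in>cyl l. measure \<mu> (sym_diff B C) < e)" for B
  have gen1: "S \<in> sets leb01 \<and> (\<exists>C\<in>cyl 1. AE x in leb01. x \<in> S \<longleftrightarrow> x \<in> C)"
    if "S \<in> sigma_sets {0..1} P" for S
    using that
  proof (induction rule: sigma_sets.induct)
    case (Basic I)
    have "AE x in leb01. x \<in> I \<longleftrightarrow> x \<in> {x \<in> {0..1}. wd 1 x = [I]}"
      using AE_regular AE_space
    proof eventually_elim
      case (elim x)
      have "x \<in> I \<longleftrightarrow> symb x = I"
        using elim(1) Basic unfolding regular_def by (metis funpow_0)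
      then show ?case using elim by (simp add: wd_def)
    qed
    then show ?case using P_sets[OF Basic] cylI(2)[where n=1 and Q="\<lambda>w. w = [I]"] by blast
  next
    case Empty
    have "{} \<in> cyl 1" using cyl_compl[OF cyl_top] by simp
    then show ?case by auto
  next
    case (Compl S)
    then obtain C where "S \<in> sets leb01" "C \<in> cyl 1" "AE x in leb01. x \<in> S \<longleftrightarrow> x \<in> C" by blast
    moreover from this(3) have "AE x in leb01. x \<in> {0..1} - S \<longleftrightarrow> x \<in> {0..1} - C" by eventually_elim simp
    moreover have "{0..1} - S \<in> sets leb01" using sets.compl_sets[OF \<open>S \<in> sets leb01\<close>] by simp
    ultimately show ?case using cyl_compl[of C 1] by blast
  next
    case (Union S)
    then have "\<forall>i. \<exists>C. C \<in> cyl 1 \<and> (AE x in leb01. x \<in> S i \<longleftrightarrow> x \<in> C)" by blast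
    from choice[OF this] obtain C where C: "\<And>i. C i \<in> cyl 1" "\<And>i. AE x in leb01. x \<in> S i \<longleftrightarrow> x \<in> C i"
      by blast
    from C(2) have "AE x in leb01. \<forall>i. x \<in> S i \<longleftrightarrow> x \<in> C i" by (simp add: AE_all_countable)
    then have "AE x in leb01. x \<in> (\<Union>i. S i) \<longleftrightarrow> x \<in> (\<Union>i. C i)" by eventually_elim simp
    moreover have "(\<Union>i. C i) \<in> cyl 1" using C(1) by (intro cyl_UN)
    moreover have "(\<Union>i. S i) \<in> sets leb01" using Union.IH by blast
    ultimately show ?case by blast
  qed
  \<comment> \<open>Here only approximation survives, since a countable union may involve words of
    unbounded length. It is first truncated to finitely many sets, which then fit into cylinder sets
    of a common length.\<close>
  have gen: "approx S" if "S \<in> sigma_join {0..1} T P" for S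
    using that unfolding sigma_join_def
  proof (induction rule: sigma_sets.induct)
    case (Basic S')
    then obtain j S where S: "S' = (T ^^ j) -` S \<inter> {0..1}" "S \<in> sigma_sets {0..1} P" by blast
    from gen1[OF S(2)] obtain C where C: "S \<in> sets leb01" "C \<in> cyl 1" "AE x in leb01. x \<in> S \<longleftrightarrow> x \<in> C" by blast
    let ?C = "(T ^^ j) -` C \<inter> {0..1}"
    have "AE x in leb01. x \<in> S' \<longleftrightarrow> x \<in> ?C"
      using AE_iterate[OF C(3), of j] unfolding S(1) by eventually_elim simp
    moreover have "S' \<in> sets leb01" unfolding S(1) using C(1) by (rule vimage_iterate_sets)
    moreover have "?C \<in> cyl (j + 1)" using C(2) by (rule cyl_vimage)
    moreover from calculation have "measure \<mu> (sym_diff S' ?C) = 0"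
      using cyl_sets[of ?C] by (intro \<mu>.measure_sym_diff_AE) (auto simp: AE_mu_iff sets_mu)
    ultimately show ?case unfolding approx_def by (metis le_add2)
  next
    case Empty
    have "{} \<in> cyl 1" using cyl_compl[OF cyl_top] by simp
    then show ?case unfolding approx_def by force
  next
    case (Compl S)
    have S: "S \<in> sets leb01" using Compl.IH by (simp add: approx_def)
    have *: "sym_diff ({0..1} - S) ({0..1} - C) = sym_diff S C" if "C \<in> cyl l" for l C
      using sets.sets_into_space[OF S] sets.sets_into_space[OF cyl_sets[OF that]] by auto
    show ?case unfolding approx_def
    proof (intro conjI allI impI)
      show "{0..1} - S \<in> sets leb01" using sets.compl_sets[OF S] by simp
      fix e :: real assume "0 < e"
      with Compl.IH obtain l C where "1 \<le> l" "C \<in> cyl l" "measure \<mu> (sym_diff S C) < e"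
        unfolding approx_def by blast
      then show "\<exists>l\<ge>1. \<exists>C\<in>cyl l. measure \<mu> (sym_diff ({0..1} - S) C) < e"
        using * cyl_compl by metis
    qed
  next
    case (Union S)
    have S: "S i \<in> sets \<mu>" for i using Union.IH unfolding approx_def sets_mu by blast
    show ?case unfolding approx_def
    proof (intro conjI allI impI)
      show "(\<Union>i. S i) \<in> sets leb01" using S unfolding sets_mu by blast
      fix e :: real assume "0 < e"
      define U where "U n = (\<Union>i<n. S i)" for n
      have Us: "U n \<in> sets \<mu>" for n using S unfolding U_def by blast
      have inc: "incseq U" by (force simp: incseq_def U_def)
      have UU: "(\<Union>n. U n) = (\<Union>i. S i)" unfolding U_def by blast
      have "(\<lambda>n. measure \<mu> (U n)) \<longlonglongrightarrow> measure \<mu> (\<Union>n. U n)"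
        using Us inc by (intro \<mu>.finite_Lim_measure_incseq) auto
      from metric_LIMSEQ_D[OF this, of "e / 2"] \<open>0 < e\<close> obtain n where
        n: "dist (measure \<mu> (U n)) (measure \<mu> (\<Union>n. U n)) < e / 2" by auto
      \<comment> \<open>Half of \<open>e\<close> is spent on the truncation, the other half is
        shared among \<open>n\<close> sets; \<open>Suc n\<close> covers the case
        \<open>n = 0\<close>.\<close>
      have "0 < e / (2 * real (Suc n))" using \<open>0 < e\<close> by simp
      then have "\<forall>i. \<exists>l C. C \<in> cyl l \<and> measure \<mu> (sym_diff (S i) C) < e / (2 * real (Suc n))"
        using Union.IH unfolding approx_def by meson
      then obtain l C where C: "\<And>i. C i \<in> cyl (l i)"
        "\<And>i. measure \<mu> (sym_diff (S i) (C i)) < e / (2 * real (Suc n))" by metis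
      define L where "L = Max (insert 1 (l ` {..<n}))"
      have L: "1 \<le> L" "\<And>i. i < n \<Longrightarrow> l i \<le> L" unfolding L_def by auto
      let ?C = "\<Union>i<n. C i"
      have CL: "?C \<in> cyl L" using C(1) L(2) by (intro cyl_UN) (auto intro: cyl_mono)
      have Cs: "C i \<in> sets \<mu>" for i using C(1) cyl_sets sets_mu by blast
      have "measure \<mu> (sym_diff (U n) ?C) \<le> measure \<mu> (\<Union>i<n. sym_diff (S i) (C i))"
        using S Cs unfolding U_def by (intro \<mu>.finite_measure_mono) auto
      also have "\<dots> \<le> (\<Sum>i<n. measure \<mu> (sym_diff (S i) (C i)))"
        using S Cs by (intro \<mu>.finite_measure_subadditive_finite) auto
      also have "\<dots> \<le> (\<Sum>i<n. e / (2 * real (Suc n)))" by (intro sum_mono less_imp_le C)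
      also have "\<dots> \<le> e / 2" using \<open>0 < e\<close> by (simp add: field_simps)
      finally have 1: "measure \<mu> (sym_diff (U n) ?C) \<le> e / 2" .
      have "sym_diff (\<Union>i. S i) (U n) = (\<Union>i. S i) - U n" unfolding U_def by blast
      then have "measure \<mu> (sym_diff (\<Union>i. S i) (U n)) = measure \<mu> (\<Union>i. S i) - measure \<mu> (U n)"
        using S Us unfolding U_def by (simp add: \<mu>.finite_measure_Diff sets.countable_UN UN_mono)
      then have 2: "measure \<mu> (sym_diff (\<Union>i. S i) (U n)) < e / 2"
        using n unfolding UU dist_real_def by linarith
      have "measure \<mu> (sym_diff (\<Union>i. S i) ?C)
          \<le> measure \<mu> (sym_diff (\<Union>i. S i) (U n)) + measure \<mu> (sym_diff (U n) ?C)"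
        using S Us Cs by (intro \<mu>.measure_sym_diff_triangle) auto
      with 1 2 have "measure \<mu> (sym_diff (\<Union>i. S i) ?C) < e" by linarith
      then show "\<exists>l\<ge>1. \<exists>C\<in>cyl l. measure \<mu> (sym_diff (\<Union>i. S i) C) < e"
        using L(1) CL by blast
    qed
  qed
  have "eq_mod leb01 (sets leb01) (sigma_join {0..1} T P)"
    using class_T unfolding class_T_def sets_mu by blast
  then obtain G where G: "G \<in> sigma_join {0..1} T P" "sym_diff B G \<in> null_sets leb01"
    using assms(1) unfolding eq_mod_def by blast
  from gen[OF G(1)] assms(2) obtain l C where C: "1 \<le> l" "C \<in> cyl l" "measure \<mu> (sym_diff G C) < e"
    and Gs: "G \<in> sets leb01" unfolding approx_def by blast
  have "measure \<mu> (sym_diff B C) \<le> measure \<mu> (sym_diff B G) + measure \<mu> (sym_diff G C)"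
    using assms(1) Gs C(2) cyl_sets by (intro \<mu>.measure_sym_diff_triangle) (auto simp: sets_mu)
  also have "measure \<mu> (sym_diff B G) = 0"
    using G(2) unfolding null_sets_mu[symmetric] by (rule measure_eq_0_null_sets)
  finally show thesis using that C by simp
qed

text \<open>Property E for fibres of words, stated through the exceptional set. At a regular point
  the atom of the refined partition and the fibre of the word differ by a null set, so they have the
  same measure.\<close>

lemma entropy_bounds:
  assumes "0 < e"
  obtains c where "0 < c" "\<And>n. 1 \<le> n \<Longrightarrow>
    measure \<mu> {x \<in> {0..1}. \<not> (set (wd n x) \<subseteq> P \<and>
        exp (- real n * (ks_entropy \<mu> T + e)) \<le> measure \<mu> (fib n x) \<and>
        measure \<mu> (fib n x) \<le> exp (- real n * (ks_entropy \<mu> T - e)))} \<le> c / real n"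
proof -
  from property_E[unfolded property_E_def, rule_format, OF assms] obtain c where c: "0 < c"
    "\<And>n. 1 \<le> n \<Longrightarrow> 1 - c / real n \<le>
      measure \<mu> {x \<in> {0..<1}. \<exists>A\<in>iter_join {0..1} T P n. x \<in> A \<and>
            exp (- real n * (ks_entropy \<mu> T + e)) \<le> measure \<mu> A \<and>
            measure \<mu> A \<le> exp (- real n * (ks_entropy \<mu> T - e))}" by blast
  show thesis
  proof (rule that[OF c(1)])
    fix n :: nat assume n: "1 \<le> n"
    define Q where "Q w \<longleftrightarrow> set w \<subseteq> P \<and>
        exp (- real n * (ks_entropy \<mu> T + e)) \<le> measure \<mu> {y \<in> {0..1}. wd n y = w} \<and>
        measure \<mu> {y \<in> {0..1}. wd n y = w} \<le> exp (- real n * (ks_entropy \<mu> T - e))" for w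
    let ?E = "{x \<in> {0..<1}. \<exists>A\<in>iter_join {0..1} T P n. x \<in> A \<and>
            exp (- real n * (ks_entropy \<mu> T + e)) \<le> measure \<mu> A \<and>
            measure \<mu> A \<le> exp (- real n * (ks_entropy \<mu> T - e))}"
    let ?F = "{x \<in> {0..1}. Q (wd n x)}"
    have F: "?F \<in> sets \<mu>" using cyl_sets[OF cylI(2)] sets_mu by blast
    have "AE x in \<mu>. x \<in> ?E \<longrightarrow> x \<in> ?F" unfolding AE_mu_iff
      using AE_regular
    proof eventually_elim
      case (elim x)
      show ?case
      proof
        assume "x \<in> ?E"
        then obtain A where x: "x \<in> {0..<1}" and A: "A \<in> iter_join {0..1} T P n" "x \<in> A"
          "exp (- real n * (ks_entropy \<mu> T + e)) \<le> measure \<mu> A"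
          "measure \<mu> A \<le> exp (- real n * (ks_entropy \<mu> T - e))" by blast
        have x': "x \<in> {0..1}" using x by (simp add: atLeastAtMost_iff)
        from A(1) obtain v where v: "set v \<subseteq> P" "length v = n" "A = atom v" by (rule iter_join_atom)
        have w: "wd n x = v" using regular_atom[OF elim x' v(1)] A(2) v by simp
        have "AE y in \<mu>. y \<in> atom v \<longleftrightarrow> y \<in> {y \<in> {0..1}. wd n y = v}"
          unfolding AE_mu_iff using AE_regular AE_space
        proof eventually_elim
          case (elim y)
          then show ?case using regular_atom[OF elim(1) _ v(1)] v(2) by simp
        qed
        then have "measure \<mu> (atom v) = measure \<mu> {y \<in> {0..1}. wd n y = v}"
          by (rule measure_eq_AE) (use atom_sets[OF v(1)] cyl_sets[OF cylI(2)] sets_mu in auto)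
        then show "x \<in> ?F" using A v w x' by (simp add: Q_def)
      qed
    qed
    \<comment> \<open>Monotonicity up to null sets asks for measurability of the larger set only,
      and \<open>?F\<close> is a cylinder set.\<close>
    then have "measure \<mu> ?E \<le> measure \<mu> ?F" using F by (rule \<mu>.finite_measure_mono_AE)
    then have "1 - measure \<mu> ?F \<le> c / real n" using c(2)[OF n] by linarith
    moreover have "1 - measure \<mu> ?F = measure \<mu> (space \<mu> - ?F)" using F by (simp add: \<mu>.prob_compl)
    moreover have "space \<mu> - ?F = {x \<in> {0..1}. \<not> Q (wd n x)}" by (auto simp: space_mu)
    ultimately show "measure \<mu> {x \<in> {0..1}. \<not> (set (wd n x) \<subseteq> P \<and>
        exp (- real n * (ks_entropy \<mu> T + e)) \<le> measure \<mu> (fib n x) \<and>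
        measure \<mu> (fib n x) \<le> exp (- real n * (ks_entropy \<mu> T - e)))} \<le> c / real n"
      by (simp add: Q_def fib_def)
  qed
qed

end

section \<open>Approximation of cylinder sets across systems\<close>


text \<open>Since \<open>J\<close> is an interval, \<open>u\<close> lies on one side of all of
  \<open>J\<close>; the end point on that side is between \<open>u\<close> and \<open>x\<close>,
  hence in \<open>U\<close>.\<close>

lemma interval_contains_endpoint:
  fixes U J :: "real set"
  assumes "is_interval U" "is_interval J" "bounded J" "x \<in> U" "x \<in> J" "u \<in> U" "u \<notin> J"
  shows "Inf J \<in> U \<or> Sup J \<in> U"
proof (cases "u \<le> x")
  case True
  have "u \<le> y" if "y \<in> J" for y
    using assms(2,5,7) that True unfolding is_interval_1 by (meson linear)
  then have "u \<le> Inf J" using assms(5) by (intro cInf_greatest) auto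
  moreover have "Inf J \<le> x" using assms(3,5) by (intro cInf_lower bounded_imp_bdd_below)
  ultimately show ?thesis using assms(1,4,6) unfolding is_interval_1 by blast
next
  case False
  have "y \<le> u" if "y \<in> J" for y
    using assms(2,5,7) that False unfolding is_interval_1 by (meson linear)
  then have "Sup J \<le> u" using assms(5) by (intro cSup_least) auto
  moreover have "x \<le> Sup J" using assms(3,5) by (intro cSup_upper bounded_imp_bdd_above)
  ultimately show ?thesis using assms(1,4,6) unfolding is_interval_1 by blast
qed

context interval_system begin

text \<open>Fibres of distinct words are disjoint and the total mass is one. The count is made for
  finite subsets first, as their uniform bound yields finiteness.\<close>

lemma finite_large_fibres:
  fixes n :: nat
  assumes "0 < a"
  defines "K \<equiv> {v. a \<le> measure \<mu> {x \<in> {0..1}. wd n x = v}}"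
  shows "finite K" "real (card K) \<le> 1 / a"
proof -
  have *: "real (card L) \<le> 1 / a" if "finite L" "L \<subseteq> K" for L
  proof -
    have s: "{x \<in> {0..1}. wd n x = v} \<in> sets \<mu>" for v
      using cyl_sets[OF cylI(2)[where n=n and Q="\<lambda>w. w = v"]] by (simp add: sets_mu)
    have "a * real (card L) \<le> (\<Sum>v\<in>L. measure \<mu> {x \<in> {0..1}. wd n x = v})"
      using that by (intro order_trans[OF _ sum_bounded_below[of L a]]) (auto simp: K_def mult.commute)
    also have "\<dots> = measure \<mu> (\<Union>v\<in>L. {x \<in> {0..1}. wd n x = v})"
      using that s by (intro \<mu>.finite_measure_finite_Union[symmetric]) (auto simp: disjoint_family_on_def)
    also have "\<dots> \<le> 1" by (rule \<mu>.prob_le_1)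
    finally show ?thesis using assms(1) by (simp add: field_simps)
  qed
  have "finite K \<and> card K \<le> nat \<lfloor>1 / a\<rfloor>"
    using * by (intro finite_if_finite_subsets_card_bdd) (auto simp: le_nat_floor)
  then show "finite K" ..
  then show "real (card K) \<le> 1 / a" by (rule *) simp
qed

lemma fib_eq: "y \<in> fib n x \<Longrightarrow> fib n y = fib n x"
  by (simp add: fib_def)

end

text \<open>Fibres of the second system of measure at least \<open>a\<close> number at most \<open>1 / a\<close>. A fibre of the
  first system that meets such an interval without being contained in it contains one of its two
  end points.\<close>

lemma cyl_approximation_step:
  assumes sT: "interval_system T \<mu> P" and sS: "interval_system S \<nu> Q"
    and "0 < a" "0 \<le> b" and B: "B \<in> interval_system.cyl S Q m"
  obtains A D where "A \<in> interval_system.cyl T P p" "A \<subseteq> B" "D \<in> sets leb01" "measure \<mu> D \<le> 2 * b / a"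
    "B - A \<subseteq> {x \<in> {0..1}. \<not> (set (interval_system.wd S Q m x) \<subseteq> Q \<and> a \<le> measure \<nu> (interval_system.fib S Q m x))}
      \<union> {x \<in> {0..1}. \<not> (set (interval_system.wd T P p x) \<subseteq> P \<and> measure \<mu> (interval_system.fib T P p x) \<le> b)} \<union> D"
proof -
  interpret T: interval_system T \<mu> P by fact
  interpret S: interval_system S \<nu> Q by fact
  from B obtain W where W: "B = {x \<in> {0..1}. S.wd m x \<in> W}" by (rule S.cylE)
  define F where "F v = {x \<in> {0..1}. S.wd m x = v}" for v
  define K where "K = {v. a \<le> measure \<nu> (F v)}"
  have K: "finite K" "real (card K) \<le> 1 / a"
    using S.finite_large_fibres[OF \<open>0 < a\<close>, of m] by (auto simp: K_def F_def)
  \<comment> \<open>The leading fibres that lie inside one large fibre contained in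
    \<open>B\<close>. The condition depends on \<open>x\<close> only through its word of length
    \<open>p\<close>, so \<open>A\<close> is a cylinder set.\<close>
  define A where "A = {x \<in> {0..1}. \<exists>v\<in>W \<inter> K. T.fib p x \<subseteq> F v}"
  \<comment> \<open>The leading fibre through \<open>y\<close>, replaced by the empty set when it
    weighs more than \<open>b\<close>. So \<open>D\<close>, two such sets for each of at most
    \<open>1 / a\<close> words, obeys its bound unconditionally; points in heavy fibres belong to
    another exceptional set.\<close>
  define G where "G y = (if measure \<mu> (T.fib p y) \<le> b then T.fib p y else {})" for y
  define D where "D = (\<Union>v\<in>K. G (Inf (F v)) \<union> G (Sup (F v)))"
  have Gs: "G y \<in> sets \<mu>" and Gb: "measure \<mu> (G y) \<le> b" for y
    using T.fib_sets T.sets_mu \<open>0 \<le> b\<close> by (auto simp: G_def)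
  show thesis
  proof
    show "A \<in> T.cyl p" unfolding A_def T.fib_def by (rule T.cylI(2))
    show "A \<subseteq> B"
    proof
      fix x assume "x \<in> A"
      then obtain v where v: "x \<in> {0..1}" "v \<in> W" "T.fib p x \<subseteq> F v" unfolding A_def by blast
      then have "x \<in> F v" by (auto simp: T.fib_def)
      then show "x \<in> B" using v by (simp add: F_def W)
    qed
    show "D \<in> sets leb01" using Gs K unfolding D_def T.sets_mu by (intro sets.finite_UN) auto
    have "measure \<mu> D \<le> (\<Sum>v\<in>K. measure \<mu> (G (Inf (F v)) \<union> G (Sup (F v))))"
      unfolding D_def using Gs K by (intro T.\<mu>.finite_measure_subadditive_finite) auto
    also have "\<dots> \<le> (\<Sum>v\<in>K. 2 * b)"
    proof (rule sum_mono)
      fix v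
      have "measure \<mu> (G (Inf (F v)) \<union> G (Sup (F v))) \<le> measure \<mu> (G (Inf (F v))) + measure \<mu> (G (Sup (F v)))"
        using Gs by (intro measure_subadditive) (auto simp: T.\<mu>.emeasure_eq_measure)
      then show "measure \<mu> (G (Inf (F v)) \<union> G (Sup (F v))) \<le> 2 * b"
        using Gb[of "Inf (F v)"] Gb[of "Sup (F v)"] by linarith
    qed
    also have "\<dots> = 2 * b * real (card K)" by simp
    also have "\<dots> \<le> 2 * b * (1 / a)" using K(2) \<open>0 \<le> b\<close> by (intro mult_left_mono) auto
    finally show "measure \<mu> D \<le> 2 * b / a" by simp
    show "B - A \<subseteq> {x \<in> {0..1}. \<not> (set (S.wd m x) \<subseteq> Q \<and> a \<le> measure \<nu> (S.fib m x))}
      \<union> {x \<in> {0..1}. \<not> (set (T.wd p x) \<subseteq> P \<and> measure \<mu> (T.fib p x) \<le> b)} \<union> D"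
    proof
      fix x assume x: "x \<in> B - A"
      have x01: "x \<in> {0..1}" using x W by simp
      have "x \<in> D" if good: "set (S.wd m x) \<subseteq> Q" "a \<le> measure \<nu> (S.fib m x)"
        "set (T.wd p x) \<subseteq> P" "measure \<mu> (T.fib p x) \<le> b"
      proof -
        let ?v = "S.wd m x"
        have Fv: "F ?v = S.fib m x" by (simp add: F_def S.fib_def)
        have v: "?v \<in> W \<inter> K" using x good(2) by (simp add: W K_def Fv)
        then obtain u where u: "u \<in> T.fib p x" "u \<notin> F ?v" using x x01 unfolding A_def by blast
        have xT: "x \<in> T.fib p x" and xS: "x \<in> F ?v" using x01 by (auto simp: T.fib_def F_def)
        have "bounded (F ?v)" by (rule bounded_subset[of "{0..1}"]) (auto simp: F_def)
        \<comment> \<open>The leading fibre of \<open>x\<close> leaves \<open>F ?v\<close> because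
          \<open>x\<close> is not in \<open>A\<close>, so it contains an end point \<open>y\<close>
          of \<open>F ?v\<close>. Fibres through \<open>x\<close> and \<open>y\<close> then
          coincide, which puts \<open>x\<close> into \<open>G y\<close>.\<close>
        from interval_contains_endpoint[OF T.is_interval_fib[OF good(3)]
            S.is_interval_fib[OF good(1), folded Fv] this xT xS u]
        obtain y where y: "y \<in> T.fib p x" "y = Inf (F ?v) \<or> y = Sup (F ?v)" by blast
        have "x \<in> G y" using T.fib_eq[OF y(1)] good(4) xT by (simp add: G_def)
        then show "x \<in> D" using y(2) v unfolding D_def by blast
      qed
      then show "x \<in> {x \<in> {0..1}. \<not> (set (S.wd m x) \<subseteq> Q \<and> a \<le> measure \<nu> (S.fib m x))}
      \<union> {x \<in> {0..1}. \<not> (set (T.wd p x) \<subseteq> P \<and> measure \<mu> (T.fib p x) \<le> b)} \<union> D"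
        using x01 by blast
    qed
  qed
qed

text \<open>With \<open>a = exp (- (m + l) * h)\<close> and \<open>b = exp (- p * H)\<close> the cut
  fibres weigh at most \<open>2 * exp ((m + l) * h - p * H)\<close>, exponentially small in
  \<open>m\<close> when \<open>p\<close> is at least \<open>\<theta> * m\<close>. The rate
  \<open>1 / m\<close> stems from the exceptional sets of property E. The fixed extra length
  \<open>l\<close> affects only the constant.\<close>

lemma cyl_approximation:
  fixes l :: nat
  assumes sT: "interval_system T \<mu> P" and sS: "interval_system S \<nu> Q"
    and lt: "ks_entropy \<nu> S < ks_entropy \<mu> T"
  obtains \<theta> K where "0 < \<theta>" "\<theta> < 1" "0 \<le> K"
    "\<And>m p B. \<lbrakk>1 \<le> m; \<theta> * real m \<le> real p; B \<in> interval_system.cyl S Q (m + l)\<rbrakk> \<Longrightarrow>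
      \<exists>A\<in>interval_system.cyl T P p. measure leb01 (sym_diff B A) \<le> K / real m"
proof -
  interpret T: interval_system T \<mu> P by fact
  interpret S: interval_system S \<nu> Q by fact
  \<comment> \<open>A third of the entropy gap: moving both entropies inwards by \<open>e\<close>
    leaves \<open>H - h = e\<close>. It also makes \<open>h\<close> positive when the smaller
    entropy is zero.\<close>
  define e where "e = (ks_entropy \<mu> T - ks_entropy \<nu> S) / 3"
  define h where "h = ks_entropy \<nu> S + e"
  define H where "H = ks_entropy \<mu> T - e"
  have e: "0 < e" using lt by (simp add: e_def)
  have Hh: "H = h + e" by (simp add: H_def h_def e_def field_simps)
  have h: "0 < h" using e by (simp add: h_def ks_entropy_def add_nonneg_pos)
  \<comment> \<open>The midpoint of \<open>h / H\<close> and \<open>1\<close>; thus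
    \<open>\<theta> * H - h\<close> is half of \<open>H - h\<close>.\<close>
  define \<theta> where "\<theta> = (h / H + 1) / 2"
  have H: "0 < H" using h e Hh by simp
  have \<theta>: "0 < \<theta>" "\<theta> < 1" using h e by (auto simp: \<theta>_def Hh field_simps add_pos_pos)
  have \<theta>H: "\<theta> * H - h = e / 2" using H by (simp add: \<theta>_def field_simps Hh)
  obtain cT where cT: "1 \<le> cT" "\<And>A. A \<in> sets leb01 \<Longrightarrow> measure leb01 A \<le> cT * measure \<mu> A"
    using T.comparable by metis
  obtain cS where cS: "1 \<le> cS" "\<And>A. A \<in> sets leb01 \<Longrightarrow> measure leb01 A \<le> cS * measure \<nu> A"
    using S.comparable by metis
  obtain dT where dT: "0 < dT" "\<And>n. 1 \<le> n \<Longrightarrow>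
    measure \<mu> {x \<in> {0..1}. \<not> (set (T.wd n x) \<subseteq> P \<and> exp (- real n * (ks_entropy \<mu> T + e)) \<le> measure \<mu> (T.fib n x) \<and>
        measure \<mu> (T.fib n x) \<le> exp (- real n * (ks_entropy \<mu> T - e)))} \<le> dT / real n"
    by (fact T.entropy_bounds[OF e])
  obtain dS where dS: "0 < dS" "\<And>n. 1 \<le> n \<Longrightarrow>
    measure \<nu> {x \<in> {0..1}. \<not> (set (S.wd n x) \<subseteq> Q \<and> exp (- real n * (ks_entropy \<nu> S + e)) \<le> measure \<nu> (S.fib n x) \<and>
        measure \<nu> (S.fib n x) \<le> exp (- real n * (ks_entropy \<nu> S - e)))} \<le> dS / real n"
    by (fact S.entropy_bounds[OF e])
  \<comment> \<open>One summand for each exceptional set and one for the cut fibres. Division by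
    \<theta> turns \<open>dT / p\<close> into a bound in \<open>m\<close>; the last summand weakens
    exponential decay by \<open>exp t \<ge> t\<close> with \<open>t = m * e / 2\<close>. The factors
    \<open>cS\<close> and \<open>cT\<close> pass to Lebesgue measure.\<close>
  define K where "K = cS * dS + cT * (dT / \<theta>) + cT * (4 * exp (real l * h) / e)"
  have "0 \<le> K" using cS cT dS dT \<theta> e by (auto simp: K_def intro!: add_nonneg_nonneg mult_nonneg_nonneg divide_nonneg_pos)
  show thesis
  proof (rule that[OF \<theta> \<open>0 \<le> K\<close>])
    fix m p B assume m: "1 \<le> m" and p: "\<theta> * real m \<le> real p" and B: "B \<in> S.cyl (m + l)"
    have "0 < \<theta> * real m" using \<theta> m by simp
    then have p1: "1 \<le> p" using p by linarith
    define a where "a = exp (- real (m + l) * h)"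
    define b where "b = exp (- real p * H)"
    have ab: "0 < a" "0 \<le> b" by (auto simp: a_def b_def)
    let ?X = "{x \<in> {0..1}. \<not> (set (S.wd (m + l) x) \<subseteq> Q \<and> a \<le> measure \<nu> (S.fib (m + l) x))}"
    let ?Y = "{x \<in> {0..1}. \<not> (set (T.wd p x) \<subseteq> P \<and> measure \<mu> (T.fib p x) \<le> b)}"
    obtain A D where A: "A \<in> T.cyl p" "A \<subseteq> B" and D: "D \<in> sets leb01" "measure \<mu> D \<le> 2 * b / a"
      and sub: "B - A \<subseteq> ?X \<union> ?Y \<union> D"
      using cyl_approximation_step[OF sT sS ab B, of p] by blast
    have Xs: "?X \<in> sets leb01" unfolding S.fib_def by (intro S.cyl_sets[OF S.cylI(2)])
    have Ys: "?Y \<in> sets leb01" unfolding T.fib_def by (intro T.cyl_sets[OF T.cylI(2)])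
    have "measure \<nu> ?X \<le> dS / real (m + l)"
    proof -
      have "measure \<nu> ?X \<le> measure \<nu> {x \<in> {0..1}. \<not> (set (S.wd (m + l) x) \<subseteq> Q \<and>
          exp (- real (m + l) * (ks_entropy \<nu> S + e)) \<le> measure \<nu> (S.fib (m + l) x) \<and>
          measure \<nu> (S.fib (m + l) x) \<le> exp (- real (m + l) * (ks_entropy \<nu> S - e)))}"
      proof (rule S.\<mu>.finite_measure_mono)
        show "{x \<in> {0..1}. \<not> (set (S.wd (m + l) x) \<subseteq> Q \<and>
          exp (- real (m + l) * (ks_entropy \<nu> S + e)) \<le> measure \<nu> (S.fib (m + l) x) \<and>
          measure \<nu> (S.fib (m + l) x) \<le> exp (- real (m + l) * (ks_entropy \<nu> S - e)))} \<in> sets \<nu>"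
          unfolding S.fib_def S.sets_mu by (intro S.cyl_sets[OF S.cylI(2)])
      qed (auto simp: a_def h_def)
      also have "\<dots> \<le> dS / real (m + l)" using m by (intro dS(2)) simp
      finally show ?thesis .
    qed
    also have "\<dots> \<le> dS / real m" using dS(1) m by (intro divide_left_mono) auto
    finally have X: "measure \<nu> ?X \<le> dS / real m" .
    have "measure \<mu> ?Y \<le> dT / real p"
    proof -
      have "measure \<mu> ?Y \<le> measure \<mu> {x \<in> {0..1}. \<not> (set (T.wd p x) \<subseteq> P \<and>
          exp (- real p * (ks_entropy \<mu> T + e)) \<le> measure \<mu> (T.fib p x) \<and>
          measure \<mu> (T.fib p x) \<le> exp (- real p * (ks_entropy \<mu> T - e)))}"
      proof (rule T.\<mu>.finite_measure_mono)
        show "{x \<in> {0..1}. \<not> (set (T.wd p x) \<subseteq> P \<and>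
          exp (- real p * (ks_entropy \<mu> T + e)) \<le> measure \<mu> (T.fib p x) \<and>
          measure \<mu> (T.fib p x) \<le> exp (- real p * (ks_entropy \<mu> T - e)))} \<in> sets \<mu>"
          unfolding T.fib_def T.sets_mu by (intro T.cyl_sets[OF T.cylI(2)])
      qed (auto simp: b_def H_def)
      also have "\<dots> \<le> dT / real p" using p1 by (intro dT(2)) simp
      finally show ?thesis .
    qed
    also have "\<dots> \<le> dT / (\<theta> * real m)" using dT(1) m p \<open>0 < \<theta> * real m\<close> by (intro divide_left_mono) auto
    finally have Y: "measure \<mu> ?Y \<le> (dT / \<theta>) / real m" by simp
    have "b / a = exp (- real p * H - (- real (m + l) * h))" by (simp only: exp_diff a_def b_def)
    moreover have "- real p * H - (- real (m + l) * h) \<le> real l * h - real m * (e / 2)"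
    proof -
      have "\<theta> * real m * H \<le> real p * H" using p H by (intro mult_right_mono) auto
      moreover have "real m * (\<theta> * H - h) = real m * (e / 2)" by (simp only: \<theta>H)
      ultimately show ?thesis by (simp add: algebra_simps)
    qed
    ultimately have "b / a \<le> exp (real l * h - real m * (e / 2))" by (simp only: exp_le_cancel_iff)
    then have "2 * b / a \<le> 2 * exp (real l * h - real m * (e / 2))" by simp
    also have "2 * exp (real l * h - real m * (e / 2)) = 2 * exp (real l * h) / exp (real m * (e / 2))"
      by (simp add: exp_diff)
    also have "\<dots> \<le> 2 * exp (real l * h) / (real m * (e / 2))"
    proof (intro divide_left_mono mult_pos_pos)
      show "real m * (e / 2) \<le> exp (real m * (e / 2))"
        using exp_ge_add_one_self[of "real m * (e / 2)"] by linarith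
    qed (use m e in auto)
    also have "\<dots> = (4 * exp (real l * h) / e) / real m" by simp
    finally have ba: "2 * b / a \<le> (4 * exp (real l * h) / e) / real m" by simp
    have "sym_diff B A = B - A" using A by blast
    then have "measure leb01 (sym_diff B A) \<le> measure leb01 (?X \<union> ?Y \<union> D)"
      using sub Xs Ys D by (simp only:) (intro leb01.finite_measure_mono, auto)
    also have "\<dots> \<le> measure leb01 ?X + measure leb01 ?Y + measure leb01 D"
      using Xs Ys D(1) by (intro order_trans[OF measure_subadditive] add_mono measure_subadditive)
        (auto simp: leb01.emeasure_eq_measure)
    also have "\<dots> \<le> cS * (dS / real m) + cT * ((dT / \<theta>) / real m) + cT * ((4 * exp (real l * h) / e) / real m)"
    proof (intro add_mono)
      show "measure leb01 ?X \<le> cS * (dS / real m)"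
        using cS(1) X by (intro order_trans[OF cS(2)[OF Xs]] mult_left_mono) auto
      show "measure leb01 ?Y \<le> cT * (dT / \<theta> / real m)"
        using cT(1) Y by (intro order_trans[OF cT(2)[OF Ys]] mult_left_mono) auto
      show "measure leb01 D \<le> cT * (4 * exp (real l * h) / e / real m)"
        using cT(1) D(2) ba by (intro order_trans[OF cT(2)[OF D(1)]] mult_left_mono) linarith+
    qed
    also have "\<dots> = K / real m" by (simp add: K_def add_divide_distrib)
    finally show "\<exists>A\<in>T.cyl p. measure leb01 (sym_diff B A) \<le> K / real m" using A(1) by blast
  qed
qed

section \<open>Averages of cylinder sets\<close>


text \<open>Once \<open>W\<close> is replaced by \<open>V\<close>, everything except the factor at
  time \<open>m\<close> is seen by words of length \<open>p\<close>; this is where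
  \<open>n + l \<le> p\<close> enters. Mixing over the gap \<open>m - p\<close> then averages that
  factor out. It is centred at its \<mu>-mean although the integral is over Lebesgue measure, as
  this is the limit that property M provides.\<close>

lemma (in interval_system) correlation_bound:
  obtains K where "0 \<le> K"
    "\<And>l n m p A V W. \<lbrakk>1 \<le> p; n + l \<le> p; p \<le> m; A \<in> cyl l; V \<in> cyl p; W \<in> sets leb01\<rbrakk> \<Longrightarrow>
      \<bar>leb01.expectation (\<lambda>x. (indicator A ((T ^^ n) x) - measure \<mu> A) *
          (indicator A ((T ^^ m) x) - measure \<mu> A) * indicator W x)\<bar>
      \<le> 4 * measure leb01 (sym_diff W V) + 2 * (K / real (Suc (m - p)))"
proof -
  obtain K where K: "0 \<le> K"
    "\<And>l n A B. \<lbrakk>1 \<le> l; A \<in> cyl l; B \<in> sets leb01\<rbrakk> \<Longrightarrow>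
      \<bar>measure leb01 (A \<inter> (T ^^ (n + l)) -` B) - measure leb01 A * measure \<mu> B\<bar> \<le> K / real (Suc n)"
    by (fact mixing)
  show thesis
  proof (rule that[OF K(1)])
    fix l n m p A V W
    assume p: "1 \<le> p" "n + l \<le> p" "p \<le> m" and A: "A \<in> cyl l" and V: "V \<in> cyl p" and W: "W \<in> sets leb01"
    define a where "a = measure \<mu> A"
    define Z where "Z q = (T ^^ q) -` A \<inter> {0..1}" for q
    have a: "0 \<le> a" "a \<le> 1" by (auto simp: a_def)
    have As: "A \<in> sets leb01" and Vs: "V \<in> sets leb01" using A V by (auto intro: cyl_sets)
    have Zs: "Z q \<in> sets leb01" for q unfolding Z_def using As by (rule vimage_iterate_sets)
    have VZ: "V \<inter> Z n \<in> cyl p"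
      unfolding Z_def by (intro cyl_Int V cyl_mono[OF cyl_vimage[OF A] p(2)])
    have mix: "\<bar>measure leb01 (B \<inter> Z m) - measure leb01 B * a\<bar> \<le> K / real (Suc (m - p))"
      if B: "B \<in> cyl p" for B
    proof -
      have "B \<inter> Z m = B \<inter> (T ^^ (m - p + p)) -` A"
        using p(3) sets.sets_into_space[OF cyl_sets[OF B]] by (auto simp: Z_def)
      then show ?thesis using K(2)[OF p(1) B As, of "m - p"] by (simp add: a_def)
    qed
    define d where "d = measure leb01 (sym_diff W V)"
    have repl: "\<bar>measure leb01 (W \<inter> Y) - measure leb01 (V \<inter> Y)\<bar> \<le> d" if Y: "Y \<in> sets leb01" for Y
    proof -
      have "measure leb01 (sym_diff (W \<inter> Y) (V \<inter> Y)) \<le> d"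
        unfolding d_def using W Vs Y by (intro leb01.finite_measure_mono) auto
      then show ?thesis
        using leb01.measure_diff_le_sym_diff[of "W \<inter> Y" "V \<inter> Y"] W Vs Y by auto
    qed
    have sp: "Y \<inter> {0..1} = Y" if "Y \<in> sets leb01" for Y
      using sets.Int_space_eq2[OF that] by simp
    have int: "integrable leb01 (indicator Y :: real \<Rightarrow> real)" if "Y \<in> sets leb01" for Y
      using that by (simp add: integrable_indicator_iff leb01.emeasure_eq_measure sp)
    have "leb01.expectation (\<lambda>x. (indicator A ((T ^^ n) x) - a) * (indicator A ((T ^^ m) x) - a) * indicator W x)
      = leb01.expectation (\<lambda>x. indicator (W \<inter> (Z n \<inter> Z m)) x - a * indicator (W \<inter> Z n) x
          - a * indicator (W \<inter> Z m) x + a * a * indicator W x)"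
      by (intro Bochner_Integration.integral_cong)
        (auto simp: Z_def indicator_def algebra_simps)
    also have "\<dots> = measure leb01 (W \<inter> (Z n \<inter> Z m)) - a * measure leb01 (W \<inter> Z n)
        - a * measure leb01 (W \<inter> Z m) + a * a * measure leb01 W"
      using W Zs int by (simp add: sp)
    \<comment> \<open>The first four brackets are the cost of replacing \<open>W\<close> by
      \<open>V\<close>, the last two are mixing errors for \<open>V \<inter> Z n\<close> and
      \<open>V\<close>; all other terms cancel. Hence the constants 4 and 2.\<close>
    also have "\<dots> = (measure leb01 (W \<inter> (Z n \<inter> Z m)) - measure leb01 (V \<inter> (Z n \<inter> Z m)))
        - a * (measure leb01 (W \<inter> Z n) - measure leb01 (V \<inter> Z n))
        - a * (measure leb01 (W \<inter> Z m) - measure leb01 (V \<inter> Z m))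
        + a * a * (measure leb01 W - measure leb01 V)
        + (measure leb01 ((V \<inter> Z n) \<inter> Z m) - measure leb01 (V \<inter> Z n) * a)
        - a * (measure leb01 (V \<inter> Z m) - measure leb01 V * a)"
      by (simp add: algebra_simps Int_assoc)
    also have "\<bar>\<dots>\<bar> \<le> d + d + d + d + K / real (Suc (m - p)) + K / real (Suc (m - p))"
    proof -
      have scale: "\<bar>c * x\<bar> \<le> y" if "\<bar>x\<bar> \<le> y" "0 \<le> c" "c \<le> 1" for c x y :: real
        using that mult_mono[of c 1 "\<bar>x\<bar>" y] by (simp add: abs_mult)
      have "\<bar>measure leb01 W - measure leb01 V\<bar> \<le> d"
        unfolding d_def using W Vs by (rule leb01.measure_diff_le_sym_diff)
      then have "\<bar>a * a * (measure leb01 W - measure leb01 V)\<bar> \<le> d"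
        using a by (intro scale) (auto simp: mult_le_one)
      moreover have "\<bar>a * (measure leb01 (W \<inter> Z q) - measure leb01 (V \<inter> Z q))\<bar> \<le> d" for q
        using a Zs by (intro scale repl) auto
      moreover have "\<bar>measure leb01 (W \<inter> (Z n \<inter> Z m)) - measure leb01 (V \<inter> (Z n \<inter> Z m))\<bar> \<le> d"
        using Zs by (intro repl) auto
      moreover have "\<bar>a * (measure leb01 (V \<inter> Z m) - measure leb01 V * a)\<bar> \<le> K / real (Suc (m - p))"
        using a by (intro scale mix[OF V]) auto
      moreover note mix[OF VZ]
      ultimately show ?thesis unfolding abs_le_iff by (smt (verit))
    qed
    finally show "\<bar>leb01.expectation (\<lambda>x. (indicator A ((T ^^ n) x) - measure \<mu> A) *
          (indicator A ((T ^^ m) x) - measure \<mu> A) * indicator W x)\<bar>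
      \<le> 4 * measure leb01 (sym_diff W V) + 2 * (K / real (Suc (m - p)))"
      unfolding a_def d_def by simp
  qed
qed

section \<open>Several systems with distinct entropies\<close>

locale interval_system_family =
  fixes T :: "'i \<Rightarrow> real \<Rightarrow> real" and \<mu> :: "'i \<Rightarrow> real measure" and P :: "'i \<Rightarrow> real set set"
    and I :: "'i set"
  assumes finite_I: "finite I"
    and sys: "\<And>i. i \<in> I \<Longrightarrow> interval_system (T i) (\<mu> i) (P i)"
    and entropy_inj: "inj_on (\<lambda>i. ks_entropy (\<mu> i) (T i)) I"
begin

lemma iterate_measurable: "i \<in> I \<Longrightarrow> (T i ^^ n) \<in> measurable leb01 leb01"
  using interval_system.measurable_iterate[OF sys] .

lemma indicator_iterate_measurable:
  assumes "i \<in> I" "A \<in> sets leb01"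
  shows "(\<lambda>x. indicator A ((T i ^^ n) x) :: real) \<in> borel_measurable leb01"
  using measurable_compose[OF iterate_measurable[OF assms(1)] borel_measurable_indicator[OF assms(2)]] .

text \<open>The factors of smaller entropy are approximated at time \<open>m\<close> by cylinder sets of the
  leading system of length \<open>p \<le> m\<close>, to which property M applies.\<close>

lemma leading_average_tendsto_zero:
  assumes t: "t \<in> I" and J: "J \<subseteq> I" and less: "\<And>i. i \<in> J \<Longrightarrow> ks_entropy (\<mu> i) (T i) < ks_entropy (\<mu> t) (T t)"
    and l: "1 \<le> l" and At: "A t \<in> interval_system.cyl (T t) (P t) l"
    and A: "\<And>i. i \<in> J \<Longrightarrow> A i \<in> interval_system.cyl (T i) (P i) l"
  shows "AE x in leb01. (\<lambda>N. (\<Sum>n<N. (indicator (A t) ((T t ^^ n) x) - measure (\<mu> t) (A t)) *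
      (\<Prod>i\<in>J. indicator (A i) ((T i ^^ n) x))) / real N) \<longlonglongrightarrow> 0"
proof -
  interpret t: interval_system "T t" "\<mu> t" "P t" using t by (rule sys)
  have finJ: "finite J" using J finite_I by (rule finite_subset)
  have sJ: "interval_system (T i) (\<mu> i) (P i)" if "i \<in> J" for i using that J sys by blast
  define a where "a = measure (\<mu> t) (A t)"
  have a: "0 \<le> a" "a \<le> 1" by (auto simp: a_def)
  define X where "X n x = (indicator (A t) ((T t ^^ n) x) - a) * (\<Prod>i\<in>J. indicator (A i) ((T i ^^ n) x))" for n x
  have Ats: "A t \<in> sets leb01" using At by (rule t.cyl_sets)
  have As: "A i \<in> sets leb01" if "i \<in> J" for i using interval_system.cyl_sets[OF sJ A] that by blast
  have Xm: "X n \<in> borel_measurable leb01" for n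
    unfolding X_def using J As Ats t
    by (intro borel_measurable_times borel_measurable_diff borel_measurable_prod
        indicator_iterate_measurable borel_measurable_const) auto
  have Xb: "\<bar>X n x\<bar> \<le> 1" for n x
  proof -
    have "\<bar>indicator (A t) ((T t ^^ n) x) - a\<bar> \<le> 1" using a by (auto simp: indicator_def)
    moreover have "\<bar>\<Prod>i\<in>J. indicator (A i) ((T i ^^ n) x) :: real\<bar> \<le> 1"
      unfolding abs_prod by (intro prod_le_1) (auto simp: indicator_def)
    ultimately show ?thesis unfolding X_def abs_mult by (simp add: mult_le_one)
  qed
  have "\<forall>i\<in>J. \<exists>\<theta> K. 0 < \<theta> \<and> \<theta> < 1 \<and> 0 \<le> K \<and>
    (\<forall>m p B. 1 \<le> m \<longrightarrow> \<theta> * real m \<le> real p \<longrightarrow> B \<in> interval_system.cyl (T i) (P i) (m + l) \<longrightarrow>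
      (\<exists>V\<in>t.cyl p. measure leb01 (sym_diff B V) \<le> K / real m))"
  proof
    fix i assume i: "i \<in> J"
    show "\<exists>\<theta> K. 0 < \<theta> \<and> \<theta> < 1 \<and> 0 \<le> K \<and>
    (\<forall>m p B. 1 \<le> m \<longrightarrow> \<theta> * real m \<le> real p \<longrightarrow> B \<in> interval_system.cyl (T i) (P i) (m + l) \<longrightarrow>
      (\<exists>V\<in>t.cyl p. measure leb01 (sym_diff B V) \<le> K / real m))"
      by (rule cyl_approximation[OF t.interval_system_axioms sJ[OF i] less[OF i], of l]) blast
  qed
  then obtain \<theta>' K' where \<theta>'K': "\<And>i. i \<in> J \<Longrightarrow> 0 < \<theta>' i \<and> \<theta>' i < 1 \<and> 0 \<le> K' i"
    and approx: "\<And>i m p B. \<lbrakk>i \<in> J; 1 \<le> m; \<theta>' i * real m \<le> real p; B \<in> interval_system.cyl (T i) (P i) (m + l)\<rbrakk> \<Longrightarrow>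
      \<exists>V\<in>t.cyl p. measure leb01 (sym_diff B V) \<le> K' i / real m"
    by metis
  \<comment> \<open>One ratio for all the systems in \<open>J\<close>; the entry
    \<open>1 / 2\<close> keeps the maximum defined when \<open>J\<close> is empty.\<close>
  define \<theta> where "\<theta> = Max (insert (1 / 2) (\<theta>' ` J))"
  have \<theta>: "0 < \<theta>" "\<theta> < 1" "\<And>i. i \<in> J \<Longrightarrow> \<theta>' i \<le> \<theta>"
    using finJ \<theta>'K' unfolding \<theta>_def by (auto simp: Max_gr_iff)
  define K1 where "K1 = (\<Sum>i\<in>J. K' i)"
  have K1: "0 \<le> K1" unfolding K1_def using \<theta>'K' by (intro sum_nonneg) auto
  obtain K where K: "0 \<le> K"
    "\<And>l n m p A V W. \<lbrakk>1 \<le> p; n + l \<le> p; p \<le> m; A \<in> t.cyl l; V \<in> t.cyl p; W \<in> sets leb01\<rbrakk> \<Longrightarrow>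
      \<bar>leb01.expectation (\<lambda>x. (indicator A ((T t ^^ n) x) - measure (\<mu> t) A) *
          (indicator A ((T t ^^ m) x) - measure (\<mu> t) A) * indicator W x)\<bar>
      \<le> 4 * measure leb01 (sym_diff W V) + 2 * (K / real (Suc (m - p)))"
    by (fact t.correlation_bound)
  \<comment> \<open>The term \<open>l\<close> covers times closer than \<open>l\<close>, where the
    trivial bound 1 is used. The term \<open>8 * K1\<close> is four times the approximation error,
    doubled since \<open>m - n + 1 \<le> 2 * m\<close>; the rest converts the gap
    \<open>m - p\<close> into \<open>m - n\<close>.\<close>
  define C where "C = real l + 8 * K1 + 2 * K * (real l + 1 + 2 / (1 - \<theta>))"
  have "0 \<le> 2 * K * (real l + 1 + 2 / (1 - \<theta>))" using K(1) \<theta>(2) by simp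
  with K1 have C: "0 \<le> C" "real l \<le> C" by (auto simp: C_def)
  have "AE x in leb01. (\<lambda>N. (\<Sum>n<N. X n x) / real N) \<longlonglongrightarrow> 0"
  proof (rule leb01.strong_law_of_correlation_decay[OF Xm Xb C(1)])
    fix n m :: nat assume nm: "n \<le> m"
    show "\<bar>leb01.expectation (\<lambda>x. X n x * X m x)\<bar> \<le> C / real (Suc (m - n))"
    proof (cases "n + l \<le> m")
      case False
      have "integrable leb01 (\<lambda>x. X n x * X m x)"
        using Xb Xm by (intro leb01.integrable_const_bound[where B=1]) (auto simp: abs_mult mult_le_one)
      then have "\<bar>leb01.expectation (\<lambda>x. X n x * X m x)\<bar> \<le> leb01.expectation (\<lambda>x. \<bar>X n x * X m x\<bar>)"
        by (intro integral_abs_bound)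
      also have "\<dots> \<le> leb01.expectation (\<lambda>x. 1)"
        using Xb by (intro Bochner_Integration.integral_mono') (auto simp: abs_mult mult_le_one)
      also have "\<dots> = 1" using leb01.prob_space by simp
      also have "1 \<le> C / real (Suc (m - n))" using False nm C by (simp add: field_simps)
      finally show ?thesis .
    next
      case True
      \<comment> \<open>The length \<open>p\<close> below is the smallest one that both sees the
        leading factor at time \<open>n\<close> and suffices for the approximations.\<close>
      define s where "s = nat \<lceil>\<theta> * real m\<rceil>"
      have s: "\<theta> * real m \<le> real s" "real s < \<theta> * real m + 1"
        unfolding s_def using \<theta>(1) by (auto simp: le_of_int_ceiling) linarith
      define p where "p = max (n + l) s"
      have m: "1 \<le> m" using True l by simp
      have "\<theta> * real m < real m" using \<theta>(2) m by simp
      then have "s \<le> m" using s(2) by linarith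
      then have p: "1 \<le> p" "n + l \<le> p" "p \<le> m" "\<theta> * real m \<le> real p"
        using True l s(1) by (auto simp: p_def)
      \<comment> \<open>Both factors of system \<open>i\<close>, at times \<open>n\<close> and
        \<open>m\<close>, merged into one cylinder set.\<close>
      define W where "W i = ((T i ^^ n) -` A i \<inter> {0..1}) \<inter> ((T i ^^ m) -` A i \<inter> {0..1})" for i
      have W: "W i \<in> interval_system.cyl (T i) (P i) (m + l)" if i: "i \<in> J" for i
        unfolding W_def using nm
        by (intro interval_system.cyl_Int[OF sJ[OF i]] interval_system.cyl_vimage[OF sJ[OF i] A[OF i]]
            interval_system.cyl_mono[OF sJ[OF i] interval_system.cyl_vimage[OF sJ[OF i] A[OF i]]]) simp
      have "\<forall>i\<in>J. \<exists>V. V \<in> t.cyl p \<and> measure leb01 (sym_diff (W i) V) \<le> K' i / real m"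
      proof
        fix i assume i: "i \<in> J"
        have "\<theta>' i * real m \<le> real p" using \<theta>(3)[OF i] p(4) mult_right_mono[of "\<theta>' i" \<theta> "real m"] by simp
        from approx[OF i m this W[OF i]] show "\<exists>V. V \<in> t.cyl p \<and> measure leb01 (sym_diff (W i) V) \<le> K' i / real m"
          by blast
      qed
      from bchoice[OF this] obtain V where V: "\<And>i. i \<in> J \<Longrightarrow> V i \<in> t.cyl p"
        "\<And>i. i \<in> J \<Longrightarrow> measure leb01 (sym_diff (W i) (V i)) \<le> K' i / real m" by blast
      have Ws: "W i \<in> sets leb01" and Vs: "V i \<in> sets leb01" if "i \<in> J" for i
        using interval_system.cyl_sets[OF sJ[OF that] W[OF that]] t.cyl_sets[OF V(1)[OF that]] by auto
      \<comment> \<open>Complements instead of an intersection, so that an empty \<open>J\<close>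
        gives the unit interval, in accordance with the empty product.\<close>
      define WW where "WW = {0..1} - (\<Union>i\<in>J. {0..1} - W i)"
      define VV where "VV = {0..1} - (\<Union>i\<in>J. {0..1} - V i)"
      have VV: "VV \<in> t.cyl p" unfolding VV_def using V(1) by (intro t.cyl_compl t.cyl_UN)
      have WWs: "WW \<in> sets leb01"
      proof -
        have "{0..1} - W i \<in> sets leb01" if "i \<in> J" for i
          using sets.compl_sets[OF Ws[OF that]] by simp
        then have "(\<Union>i\<in>J. {0..1} - W i) \<in> sets leb01" using finJ by (intro sets.finite_UN)
        then show ?thesis unfolding WW_def using sets.compl_sets[of _ leb01] by simp
      qed
      have "sym_diff WW VV \<subseteq> (\<Union>i\<in>J. sym_diff (W i) (V i))" unfolding WW_def VV_def by blast
      then have "measure leb01 (sym_diff WW VV) \<le> measure leb01 (\<Union>i\<in>J. sym_diff (W i) (V i))"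
        using finJ Ws Vs by (intro leb01.finite_measure_mono) auto
      also have "\<dots> \<le> (\<Sum>i\<in>J. measure leb01 (sym_diff (W i) (V i)))"
        using finJ Ws Vs by (intro leb01.finite_measure_subadditive_finite) auto
      also have "\<dots> \<le> (\<Sum>i\<in>J. K' i / real m)" using V(2) by (intro sum_mono)
      also have "\<dots> = K1 / real m" by (simp add: K1_def sum_divide_distrib)
      finally have d: "measure leb01 (sym_diff WW VV) \<le> K1 / real m" .
      have "X n x * X m x = (indicator (A t) ((T t ^^ n) x) - a) * (indicator (A t) ((T t ^^ m) x) - a) * indicator WW x"
        if "x \<in> {0..1}" for x
      proof -
        have "(\<Prod>i\<in>J. indicator (A i) ((T i ^^ n) x)) * (\<Prod>i\<in>J. indicator (A i) ((T i ^^ m) x))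
            = (\<Prod>i\<in>J. indicator (W i) x :: real)"
          unfolding prod.distrib[symmetric] using that by (intro prod.cong) (auto simp: W_def indicator_def)
        also have "\<dots> = indicator WW x"
          using finJ that by (auto simp: WW_def indicator_def prod_eq_1_iff)
        finally show ?thesis by (simp add: X_def algebra_simps)
      qed
      then have "\<bar>leb01.expectation (\<lambda>x. X n x * X m x)\<bar>
          = \<bar>leb01.expectation (\<lambda>x. (indicator (A t) ((T t ^^ n) x) - a) * (indicator (A t) ((T t ^^ m) x) - a) * indicator WW x)\<bar>"
        by (intro arg_cong[where f=abs] Bochner_Integration.integral_cong) auto
      also have "\<dots> \<le> 4 * measure leb01 (sym_diff WW VV) + 2 * (K / real (Suc (m - p)))"
        unfolding a_def by (intro K(2)[OF p(1-3) At VV WWs])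
      also have "\<dots> \<le> 4 * (2 * K1 / real (Suc (m - n))) + 2 * (K * ((real l + 1 + 2 / (1 - \<theta>)) / real (Suc (m - n))))"
      proof -
        have m2: "real (Suc (m - n)) \<le> 2 * real m" using m by simp
        have "K1 / real m = 2 * K1 / (2 * real m)" by simp
        also have "\<dots> \<le> 2 * K1 / real (Suc (m - n))" using K1 m2 by (intro divide_left_mono) auto
        finally have 1: "measure leb01 (sym_diff WW VV) \<le> 2 * K1 / real (Suc (m - n))" using d by linarith
        \<comment> \<open>The mixing gap is comparable to \<open>m - n\<close>: for
          \<open>p = n + l\<close> it falls short of it by \<open>l\<close> only, and for
          \<open>p = s\<close> it is at least \<open>(1 - \<theta>) * m - 1\<close>.\<close>
        have "1 / real (Suc (m - p)) \<le> (real l + 1 + 2 / (1 - \<theta>)) / real (Suc (m - n))"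
        proof (cases "s \<le> n + l")
          case True
          then have pl: "p = n + l" by (simp add: p_def)
          have "real (Suc (m - n)) \<le> (real l + 1) * real (Suc (m - p))"
          proof -
            define r where "r = m - p"
            have "m = n + l + r" using p(3) pl by (simp add: r_def)
            then have "Suc (m - n) \<le> (l + 1) * Suc r" by simp
            then have "real (Suc (m - n)) \<le> real ((l + 1) * Suc r)" by (simp only: of_nat_le_iff)
            then show ?thesis unfolding r_def by (simp only: of_nat_mult of_nat_add of_nat_1)
          qed
          then have "1 / real (Suc (m - p)) \<le> (real l + 1) / real (Suc (m - n))"
            by (simp add: divide_simps del: of_nat_Suc)
          also have "\<dots> \<le> (real l + 1 + 2 / (1 - \<theta>)) / real (Suc (m - n))"
            using \<theta>(2) by (intro divide_right_mono) auto
          finally show ?thesis .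
        next
          case False
          then have ps: "p = s" by (simp add: p_def)
          have "(1 - \<theta>) * real m \<le> real (Suc (m - p))"
            using s(2) p(3) unfolding ps by (simp add: algebra_simps of_nat_diff)
          moreover have pos: "0 < (1 - \<theta>) * real m" using \<theta>(2) m by simp
          ultimately have "1 / real (Suc (m - p)) \<le> 1 / ((1 - \<theta>) * real m)"
            by (intro divide_left_mono) auto
          also have "\<dots> = (2 / (1 - \<theta>)) / (2 * real m)" by simp
          also have "\<dots> \<le> (2 / (1 - \<theta>)) / real (Suc (m - n))"
            using m2 \<theta>(2) m by (intro divide_left_mono) auto
          also have "\<dots> \<le> (real l + 1 + 2 / (1 - \<theta>)) / real (Suc (m - n))"
            by (intro divide_right_mono) auto
          finally show ?thesis .
        qed
        then have "K * (1 / real (Suc (m - p))) \<le> K * ((real l + 1 + 2 / (1 - \<theta>)) / real (Suc (m - n)))"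
          using K(1) by (rule mult_left_mono)
        with 1 show ?thesis by simp
      qed
      also have "\<dots> = (8 * K1 + 2 * K * (real l + 1 + 2 / (1 - \<theta>))) / real (Suc (m - n))"
      proof -
        have "4 * (2 * k / r) + 2 * (K * (c / r)) = (8 * k + 2 * K * c) / r" for k c r :: real
          by (simp add: add_divide_distrib)
        then show ?thesis .
      qed
      also have "\<dots> \<le> C / real (Suc (m - n))"
        unfolding C_def by (intro divide_right_mono) auto
      finally show ?thesis .
    qed
  qed
  then show ?thesis unfolding X_def a_def .
qed

text \<open>The ranking induction adds systems in order of entropy, so the new one always leads,
  strictly because entropies are distinct. Writing its indicator as centred part plus mean leaves an
  average that vanishes and one over the earlier systems.\<close>

lemma cylinder_average:
  assumes l: "1 \<le> l" and A: "\<And>i. i \<in> I \<Longrightarrow> A i \<in> interval_system.cyl (T i) (P i) l"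
  shows "AE x in leb01. (\<lambda>N. (\<Sum>n<N. \<Prod>i\<in>I. indicator (A i) ((T i ^^ n) x)) / real N)
    \<longlonglongrightarrow> (\<Prod>i\<in>I. measure (\<mu> i) (A i))"
proof -
  have "J \<subseteq> I \<longrightarrow> (AE x in leb01. (\<lambda>N. (\<Sum>n<N. \<Prod>i\<in>J. indicator (A i) ((T i ^^ n) x)) / real N)
    \<longlonglongrightarrow> (\<Prod>i\<in>J. measure (\<mu> i) (A i)))" if "finite J" for J
    using that
  proof (induction J rule: finite_ranking_induct[where f="\<lambda>i. ks_entropy (\<mu> i) (T i)"])
    case empty
    \<comment> \<open>The quotient is \<open>0\<close> at \<open>N = 0\<close>, so it equals one
      only eventually.\<close>
    have "(\<lambda>N. real N / real N) \<longlonglongrightarrow> 1"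
      by (rule tendsto_eventually) (auto intro!: eventually_sequentiallyI[of 1])
    then show ?case by simp
  next
    case (insert t J)
    show ?case
    proof (cases "t \<in> J")
      case True
      then show ?thesis using insert by (simp add: insert_absorb)
    next
      case notin: False
      show ?thesis
      proof
        assume sub: "insert t J \<subseteq> I"
        have "ks_entropy (\<mu> i) (T i) < ks_entropy (\<mu> t) (T t)" if "i \<in> J" for i
          using insert.hyps(2)[OF that] inj_onD[OF entropy_inj, of i t] sub that notin
          by (metis insert_subset less_le subsetD)
        then have "AE x in leb01. (\<lambda>N. (\<Sum>n<N. (indicator (A t) ((T t ^^ n) x) - measure (\<mu> t) (A t)) *
      (\<Prod>i\<in>J. indicator (A i) ((T i ^^ n) x))) / real N) \<longlonglongrightarrow> 0"
          using sub A l by (intro leading_average_tendsto_zero[where l=l]) auto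
        moreover have "AE x in leb01. (\<lambda>N. (\<Sum>n<N. \<Prod>i\<in>J. indicator (A i) ((T i ^^ n) x)) / real N)
            \<longlonglongrightarrow> (\<Prod>i\<in>J. measure (\<mu> i) (A i))" using insert.IH sub by simp
        ultimately show "AE x in leb01. (\<lambda>N. (\<Sum>n<N. \<Prod>i\<in>insert t J. indicator (A i) ((T i ^^ n) x)) / real N)
          \<longlonglongrightarrow> (\<Prod>i\<in>insert t J. measure (\<mu> i) (A i))"
        proof eventually_elim
          case (elim x)
          let ?a = "measure (\<mu> t) (A t)"
          have "(\<lambda>N. (\<Sum>n<N. (indicator (A t) ((T t ^^ n) x) - ?a) *
              (\<Prod>i\<in>J. indicator (A i) ((T i ^^ n) x))) / real N
              + ?a * ((\<Sum>n<N. \<Prod>i\<in>J. indicator (A i) ((T i ^^ n) x)) / real N))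
            \<longlonglongrightarrow> 0 + ?a * (\<Prod>i\<in>J. measure (\<mu> i) (A i))"
            by (intro tendsto_add tendsto_mult tendsto_const elim)
          then show ?case using insert.hyps(1) notin
            by (simp add: add_divide_distrib[symmetric] sum_distrib_left sum.distrib[symmetric] algebra_simps)
        qed
      qed
    qed
  qed
  from this[OF finite_I] show ?thesis by simp
qed

end

section \<open>From cylinder sets to bounded functions\<close>


text \<open>An exchange of limits: the error \<open>e j\<close> must be uniform in \<open>N\<close>,
  which for averages of sets is what the maximal inequality supplies.\<close>

lemma tendsto_of_approximations:
  fixes X :: "nat \<Rightarrow> 'a::real_normed_vector"
  assumes Y: "\<And>j. Y j \<longlonglongrightarrow> L j" and L: "L \<longlonglongrightarrow> l" and e: "e \<longlonglongrightarrow> 0"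
    and approx: "\<forall>\<^sub>F j in sequentially. \<forall>N. norm (X N - Y j N) \<le> e j"
  shows "X \<longlonglongrightarrow> l"
proof (rule LIMSEQ_I)
  fix r :: real assume r: "0 < r"
  then have "0 < r / 3" by simp
  have "\<forall>\<^sub>F j in sequentially. e j < r / 3"
    using order_tendstoD(2)[OF e \<open>0 < r / 3\<close>] .
  moreover have "\<forall>\<^sub>F j in sequentially. norm (L j - l) < r / 3"
    using tendstoD[OF L \<open>0 < r / 3\<close>] by (simp add: dist_norm)
  ultimately have "\<forall>\<^sub>F j in sequentially. e j < r / 3 \<and> norm (L j - l) < r / 3 \<and> (\<forall>N. norm (X N - Y j N) \<le> e j)"
    using approx by eventually_elim simp
  then obtain j where j: "e j < r / 3" "norm (L j - l) < r / 3" "\<And>N. norm (X N - Y j N) \<le> e j"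
    unfolding eventually_sequentially by blast
  from LIMSEQ_D[OF Y \<open>0 < r / 3\<close>, of j] obtain M where M: "\<And>N. M \<le> N \<Longrightarrow> norm (Y j N - L j) < r / 3" by blast
  have "norm (X N - l) < r" if "M \<le> N" for N
  proof -
    have "X N - l = (X N - Y j N) + (Y j N - L j) + (L j - l)" by simp
    then have "norm (X N - l) \<le> norm (X N - Y j N) + norm (Y j N - L j) + norm (L j - l)"
      by (metis norm_triangle_ineq norm_triangle_le add_mono order_refl)
    then show ?thesis using j(1,2) j(3)[of N] M[OF that] by linarith
  qed
  then show "\<exists>M. \<forall>N\<ge>M. norm (X N - l) < r" by blast
qed

text \<open>For factors in the unit ball the difference of two products is at most the sum of the
  differences of the factors. The error thus splits into averages along single systems, each of
  which has its own invariant measure.\<close>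

lemma norm_average_prod_diff:
  fixes z w :: "'i \<Rightarrow> nat \<Rightarrow> 'a::{real_normed_field}"
  assumes "\<And>i n. i \<in> I \<Longrightarrow> norm (z i n) \<le> 1" "\<And>i n. i \<in> I \<Longrightarrow> norm (w i n) \<le> 1"
    and "\<And>i. i \<in> I \<Longrightarrow> (\<Sum>n<N. norm (z i n - w i n)) \<le> e * real N" and "0 \<le> e"
  shows "norm ((\<Sum>n<N. \<Prod>i\<in>I. z i n) / of_nat N - (\<Sum>n<N. \<Prod>i\<in>I. w i n) / of_nat N) \<le> real (card I) * e"
proof (cases "N = 0")
  case True
  then show ?thesis using assms(4) by simp
next
  case False
  have "norm ((\<Sum>n<N. \<Prod>i\<in>I. z i n) - (\<Sum>n<N. \<Prod>i\<in>I. w i n)) \<le> (\<Sum>n<N. norm ((\<Prod>i\<in>I. z i n) - (\<Prod>i\<in>I. w i n)))"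
    unfolding sum_subtractf[symmetric] by (rule norm_sum)
  also have "\<dots> \<le> (\<Sum>n<N. \<Sum>i\<in>I. norm (z i n - w i n))"
    using assms(1,2) by (intro sum_mono norm_prod_diff)
  also have "\<dots> = (\<Sum>i\<in>I. \<Sum>n<N. norm (z i n - w i n))" by (rule sum.swap)
  also have "\<dots> \<le> (\<Sum>i\<in>I. e * real N)" by (intro sum_mono assms(3))
  finally show ?thesis using False
    by (simp add: diff_divide_distrib[symmetric] norm_divide field_simps)
qed

context interval_system begin

text \<open>The maximal inequality at level \<open>(1 / 2) ^ j\<close> costs one factor
  \<open>2 ^ j\<close> of the bound \<open>(1 / 4) ^ j\<close>; the remaining
  \<open>(1 / 2) ^ j\<close> is summable, as Borel-Cantelli requires.\<close>

lemma AE_small_averages: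
  assumes D: "\<And>j. D j \<in> sets leb01" "\<And>j. measure \<mu> (D j) \<le> (1 / 4) ^ j"
  shows "AE x in leb01. \<forall>\<^sub>F j in sequentially. \<forall>N. (\<Sum>n<N. indicator (D j) ((T ^^ n) x)) \<le> (1 / 2) ^ j * real N"
proof -
  have Tm: "T \<in> measurable \<mu> \<mu>" using measurable_T measurable_cong_sets[OF sets_mu sets_mu] by simp
  define U where "U j = {x \<in> space \<mu>. \<exists>N. (1 / 2) ^ j * real N < (\<Sum>n<N. indicator (D j) ((T ^^ n) x))}" for j
  have U: "U j \<in> sets \<mu>" "measure \<mu> (U j) \<le> (1 / 2) ^ j" for j
  proof -
    have Ds: "D j \<in> sets \<mu>" using D(1) by (simp add: sets_mu)
    have p: "(0::real) < (1 / 2) ^ j" by simp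
    note max = \<mu>.maximal_inequality_indicator[OF Tm distr_T Ds p]
    show "U j \<in> sets \<mu>" unfolding U_def by (rule max(1))
    have "measure \<mu> (U j) \<le> measure \<mu> (D j) / (1 / 2) ^ j" unfolding U_def by (rule max(2))
    also have "\<dots> \<le> (1 / 4) ^ j / (1 / 2) ^ j" using D(2) by (intro divide_right_mono) auto
    also have "\<dots> = (1 / 2) ^ j" by (simp flip: power_divide)
    finally show "measure \<mu> (U j) \<le> (1 / 2) ^ j" .
  qed
  have "summable (\<lambda>j. measure \<mu> (U j))"
    by (rule summable_comparison_test'[of "\<lambda>j. (1 / 2) ^ j" 0]) (use U(2) in \<open>auto intro!: summable_geometric\<close>)
  then have "AE x in \<mu>. \<forall>\<^sub>F j in sequentially. x \<in> space \<mu> - U j"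
    using U(1) by (intro borel_cantelli_AE1) (auto simp: \<mu>.emeasure_eq_measure)
  then show ?thesis unfolding AE_mu_iff
  proof eventually_elim
    case (elim x)
    then show ?case
    proof eventually_elim
      case (elim j)
      then have "x \<in> space \<mu>" "x \<notin> U j" by auto
      then show ?case unfolding U_def by (auto simp: not_less)
    qed
  qed
qed

lemma cyl_dense_sequence:
  assumes "B \<in> sets leb01"
  obtains l C where "\<And>j. 1 \<le> l j" "\<And>j. C j \<in> cyl (l j)" "\<And>j. measure \<mu> (sym_diff B (C j)) \<le> (1 / 4) ^ j"
proof -
  have "\<forall>j::nat. \<exists>l C. 1 \<le> l \<and> C \<in> cyl l \<and> measure \<mu> (sym_diff B C) \<le> (1 / 4) ^ j"
  proof
    fix j :: nat
    have "(0::real) < (1 / 4) ^ j" by simp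
    from cyl_dense[OF assms this] obtain l C where "1 \<le> l" "C \<in> cyl l" "measure \<mu> (sym_diff B C) < (1 / 4) ^ j" .
    then show "\<exists>l C. 1 \<le> l \<and> C \<in> cyl l \<and> measure \<mu> (sym_diff B C) \<le> (1 / 4) ^ j"
      by (meson less_imp_le)
  qed
  then obtain l C where "\<And>j. 1 \<le> l j \<and> C j \<in> cyl (l j) \<and> measure \<mu> (sym_diff B (C j)) \<le> (1 / 4) ^ j" by metis
  then show thesis by (intro that[of l C]) auto
qed

end

context interval_system_family begin

text \<open>At almost every point, for all large \<open>j\<close>, replacing each \<open>B i\<close>
  by its \<open>j\<close>-th cylinder approximation changes every average by at most
  \<open>card I * (1 / 2) ^ j\<close>. The limits of the approximating averages converge because the
  measures do.\<close>

lemma set_average: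
  assumes B: "\<And>i. i \<in> I \<Longrightarrow> B i \<in> sets leb01"
  shows "AE x in leb01. (\<lambda>N. (\<Sum>n<N. \<Prod>i\<in>I. indicator (B i) ((T i ^^ n) x)) / real N)
    \<longlonglongrightarrow> (\<Prod>i\<in>I. measure (\<mu> i) (B i))"
proof -
  have "\<forall>i\<in>I. \<exists>l C. (\<forall>j. 1 \<le> l j) \<and> (\<forall>j. C j \<in> interval_system.cyl (T i) (P i) (l j))
      \<and> (\<forall>j. measure (\<mu> i) (sym_diff (B i) (C j)) \<le> (1 / 4) ^ j)"
  proof
    fix i assume i: "i \<in> I"
    show "\<exists>l C. (\<forall>j. 1 \<le> l j) \<and> (\<forall>j. C j \<in> interval_system.cyl (T i) (P i) (l j))
      \<and> (\<forall>j. measure (\<mu> i) (sym_diff (B i) (C j)) \<le> (1 / 4) ^ j)"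
      by (rule interval_system.cyl_dense_sequence[OF sys[OF i] B[OF i]]) blast
  qed
  then obtain l C where lC: "\<And>i j. i \<in> I \<Longrightarrow> 1 \<le> (l i j :: nat)"
    "\<And>i j. i \<in> I \<Longrightarrow> C i j \<in> interval_system.cyl (T i) (P i) (l i j)"
    "\<And>i j. i \<in> I \<Longrightarrow> measure (\<mu> i) (sym_diff (B i) (C i j)) \<le> (1 / 4) ^ j" by metis
  have Cs: "C i j \<in> sets leb01" if "i \<in> I" for i j
    using interval_system.cyl_sets[OF sys[OF that] lC(2)[OF that]] .
  have conv: "AE x in leb01. \<forall>j. (\<lambda>N. (\<Sum>n<N. \<Prod>i\<in>I. indicator (C i j) ((T i ^^ n) x)) / real N)
    \<longlonglongrightarrow> (\<Prod>i\<in>I. measure (\<mu> i) (C i j))"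
  proof (subst AE_all_countable, intro allI)
    fix j
    define L where "L = Max (insert 1 ((\<lambda>i. l i j) ` I))"
    have "1 \<le> L" "\<And>i. i \<in> I \<Longrightarrow> l i j \<le> L" unfolding L_def using finite_I by auto
    then show "AE x in leb01. (\<lambda>N. (\<Sum>n<N. \<Prod>i\<in>I. indicator (C i j) ((T i ^^ n) x)) / real N)
      \<longlonglongrightarrow> (\<Prod>i\<in>I. measure (\<mu> i) (C i j))"
      using lC(2) by (intro cylinder_average[of L]) (auto intro: interval_system.cyl_mono[OF sys])
  qed
  have small: "AE x in leb01. \<forall>i\<in>I. \<forall>\<^sub>F j in sequentially. \<forall>N.
      (\<Sum>n<N. indicator (sym_diff (B i) (C i j)) ((T i ^^ n) x)) \<le> (1 / 2) ^ j * real N"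
    using B Cs lC(3) by (intro AE_finite_allI[OF finite_I] interval_system.AE_small_averages[OF sys]) auto
  have lim: "(\<lambda>j. \<Prod>i\<in>I. measure (\<mu> i) (C i j)) \<longlonglongrightarrow> (\<Prod>i\<in>I. measure (\<mu> i) (B i))"
  proof (rule tendsto_prod)
    fix i assume i: "i \<in> I"
    interpret i: interval_system "T i" "\<mu> i" "P i" using i by (rule sys)
    have "norm (measure (\<mu> i) (C i j) - measure (\<mu> i) (B i)) \<le> (1 / 4) ^ j" for j
      using i.\<mu>.measure_diff_le_sym_diff[of "B i" "C i j"] B[OF i] Cs[OF i] lC(3)[OF i, of j]
      by (simp add: i.sets_mu abs_minus_commute)
    then have "\<forall>\<^sub>F j in sequentially. norm (measure (\<mu> i) (C i j) - measure (\<mu> i) (B i)) \<le> (1 / 4) ^ j"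
      by (intro always_eventually allI)
    moreover have "(\<lambda>j. (1 / 4 :: real) ^ j) \<longlonglongrightarrow> 0" by (rule LIMSEQ_power_zero) simp
    ultimately have "(\<lambda>j. measure (\<mu> i) (C i j) - measure (\<mu> i) (B i)) \<longlonglongrightarrow> 0"
      by (rule Lim_null_comparison)
    then show "(\<lambda>j. measure (\<mu> i) (C i j)) \<longlonglongrightarrow> measure (\<mu> i) (B i)" by (rule LIM_zero_cancel)
  qed
  show ?thesis using conv small
  proof eventually_elim
    case (elim x)
    show ?case
    proof (rule tendsto_of_approximations[OF _ lim])
      show "(\<lambda>j. real (card I) * (1 / 2) ^ j) \<longlonglongrightarrow> 0"
        by (intro tendsto_mult_right_zero LIMSEQ_power_zero) simp
      show "(\<lambda>N. (\<Sum>n<N. \<Prod>i\<in>I. indicator (C i j) ((T i ^^ n) x)) / real N)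
          \<longlonglongrightarrow> (\<Prod>i\<in>I. measure (\<mu> i) (C i j))" for j using elim(1) by blast
      have "\<forall>\<^sub>F j in sequentially. \<forall>i\<in>I. \<forall>N.
        (\<Sum>n<N. indicator (sym_diff (B i) (C i j)) ((T i ^^ n) x)) \<le> (1 / 2) ^ j * real N"
        using elim(2) finite_I by (simp add: eventually_ball_finite)
      then show "\<forall>\<^sub>F j in sequentially. \<forall>N. norm ((\<Sum>n<N. \<Prod>i\<in>I. indicator (B i) ((T i ^^ n) x)) / real N
          - (\<Sum>n<N. \<Prod>i\<in>I. indicator (C i j) ((T i ^^ n) x)) / real N) \<le> real (card I) * (1 / 2) ^ j"
      proof eventually_elim
        case (elim j)
        have eq: "norm (indicator (B i) y - indicator (C i j) y :: real) = indicator (sym_diff (B i) (C i j)) y" for i y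
          by (auto simp: indicator_def)
        show ?case
        proof
          fix N
          show "norm ((\<Sum>n<N. \<Prod>i\<in>I. indicator (B i) ((T i ^^ n) x)) / real N
            - (\<Sum>n<N. \<Prod>i\<in>I. indicator (C i j) ((T i ^^ n) x)) / real N) \<le> real (card I) * (1 / 2) ^ j"
            using elim by (intro norm_average_prod_diff) (auto simp only: eq, auto simp: indicator_def)
        qed
      qed
    qed
  qed
qed

text \<open>Expanding the product of finite sums gives one weighted product of indicators for each
  choice \<open>\<phi>\<close> of values. The choices are finite in number, so their exceptional
  null sets can be united.\<close>

lemma finite_range_average:
  fixes s :: "'i \<Rightarrow> real \<Rightarrow> complex"
  assumes s: "\<And>i. i \<in> I \<Longrightarrow> s i \<in> borel_measurable leb01" and V: "finite V"
    and sV: "\<And>i x. i \<in> I \<Longrightarrow> s i x \<in> V"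
  shows "AE x in leb01. (\<lambda>N. (\<Sum>n<N. \<Prod>i\<in>I. s i ((T i ^^ n) x)) / of_nat N)
    \<longlonglongrightarrow> (\<Prod>i\<in>I. \<integral>x. s i x \<partial>(\<mu> i))"
proof -
  define B where "B i v = s i -` {v} \<inter> {0..1}" for i v
  have Bs: "B i v \<in> sets leb01" if "i \<in> I" for i v
    using measurable_sets[OF s[OF that], of "{v}"] by (simp add: B_def)
  have "AE x in leb01. \<forall>\<phi>\<in>PiE I (\<lambda>_. V). (\<lambda>N. (\<Sum>n<N. \<Prod>i\<in>I. indicator (B i (\<phi> i)) ((T i ^^ n) x)) / real N)
    \<longlonglongrightarrow> (\<Prod>i\<in>I. measure (\<mu> i) (B i (\<phi> i)))"
    using Bs V finite_I by (intro AE_finite_allI finite_PiE set_average) auto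
  then show ?thesis using AE_space
  proof eventually_elim
    case (elim x)
    have x: "x \<in> {0..1}" using elim(2) by simp
    have s_eq: "s i y = (\<Sum>v\<in>V. v * of_real (indicator (B i v) y))" if "i \<in> I" "y \<in> {0..1}" for i y
    proof -
      have "(\<Sum>v\<in>V. v * of_real (indicator (B i v) y)) = (\<Sum>v\<in>V. if v = s i y then v else 0)"
        using that by (intro sum.cong) (auto simp: B_def indicator_def)
      then show ?thesis using V sV[OF that(1)] by simp
    qed
    have prod_eq: "(\<Prod>i\<in>I. s i ((T i ^^ n) x)) = (\<Sum>\<phi>\<in>PiE I (\<lambda>_. V). (\<Prod>i\<in>I. \<phi> i) *
        of_real (\<Prod>i\<in>I. indicator (B i (\<phi> i)) ((T i ^^ n) x)))" for n
    proof -
      have "(\<Prod>i\<in>I. s i ((T i ^^ n) x)) = (\<Prod>i\<in>I. \<Sum>v\<in>V. v * of_real (indicator (B i v) ((T i ^^ n) x)))"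
        using interval_system.T_iterate_in[OF sys x] by (intro prod.cong s_eq) auto
      then show ?thesis using V finite_I by (simp add: prod_sum_PiE prod.distrib)
    qed
    have int_eq: "(\<integral>x. s i x \<partial>(\<mu> i)) = (\<Sum>v\<in>V. v * of_real (measure (\<mu> i) (B i v)))" if i: "i \<in> I" for i
    proof -
      interpret i: interval_system "T i" "\<mu> i" "P i" using i by (rule sys)
      have "(\<integral>x. s i x \<partial>(\<mu> i)) = (\<integral>x. (\<Sum>v\<in>V. v * of_real (indicator (B i v) x)) \<partial>(\<mu> i))"
        using s_eq[OF i] by (intro Bochner_Integration.integral_cong) (auto simp: i.space_mu)
      also have "\<dots> = (\<Sum>v\<in>V. \<integral>x. v * of_real (indicator (B i v) x) \<partial>(\<mu> i))"
        using Bs[OF i] by (intro Bochner_Integration.integral_sum integrable_mult_right integrable_of_real)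
          (auto simp: i.sets_mu i.\<mu>.emeasure_eq_measure integrable_indicator_iff)
      also have "\<dots> = (\<Sum>v\<in>V. v * of_real (measure (\<mu> i) (B i v)))"
        using Bs[OF i] by (intro sum.cong refl) (simp add: B_def i.space_mu[symmetric] i.sets_mu)
      finally show ?thesis .
    qed
    have "(\<lambda>N. \<Sum>\<phi>\<in>PiE I (\<lambda>_. V). (\<Prod>i\<in>I. \<phi> i) *
        of_real ((\<Sum>n<N. \<Prod>i\<in>I. indicator (B i (\<phi> i)) ((T i ^^ n) x)) / real N))
      \<longlonglongrightarrow> (\<Sum>\<phi>\<in>PiE I (\<lambda>_. V). (\<Prod>i\<in>I. \<phi> i) * of_real (\<Prod>i\<in>I. measure (\<mu> i) (B i (\<phi> i))))"
      using elim(1) by (intro tendsto_sum tendsto_mult tendsto_const tendsto_of_real) auto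
    also have "(\<Sum>\<phi>\<in>PiE I (\<lambda>_. V). (\<Prod>i\<in>I. \<phi> i) * of_real (\<Prod>i\<in>I. measure (\<mu> i) (B i (\<phi> i))))
        = (\<Prod>i\<in>I. \<integral>x. s i x \<partial>(\<mu> i))"
      using V finite_I by (simp add: int_eq prod_sum_PiE prod.distrib)
    also have "(\<lambda>N. \<Sum>\<phi>\<in>PiE I (\<lambda>_. V). (\<Prod>i\<in>I. \<phi> i) *
        of_real ((\<Sum>n<N. \<Prod>i\<in>I. indicator (B i (\<phi> i)) ((T i ^^ n) x)) / real N))
      = (\<lambda>N. (\<Sum>n<N. \<Prod>i\<in>I. s i ((T i ^^ n) x)) / of_nat N)"
    proof
      fix N
      have "(\<Sum>n<N. \<Prod>i\<in>I. s i ((T i ^^ n) x)) = (\<Sum>\<phi>\<in>PiE I (\<lambda>_. V). \<Sum>n<N. (\<Prod>i\<in>I. \<phi> i) *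
        of_real (\<Prod>i\<in>I. indicator (B i (\<phi> i)) ((T i ^^ n) x)))"
        unfolding prod_eq by (rule sum.swap)
      then show "(\<Sum>\<phi>\<in>PiE I (\<lambda>_. V). (\<Prod>i\<in>I. \<phi> i) *
        of_real ((\<Sum>n<N. \<Prod>i\<in>I. indicator (B i (\<phi> i)) ((T i ^^ n) x)) / real N))
        = (\<Sum>n<N. \<Prod>i\<in>I. s i ((T i ^^ n) x)) / of_nat N"
        by (simp add: sum_divide_distrib sum_distrib_left)
    qed
    finally show ?case .
  qed
qed

end

section \<open>Rounding complex values to a grid, and bounded functions\<close>

definition grid_round :: "nat \<Rightarrow> complex \<Rightarrow> complex" where
  "grid_round k z = Complex (of_int \<lfloor>Re z * real k\<rfloor> / real k) (of_int \<lfloor>Im z * real k\<rfloor> / real k)"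

lemma borel_measurable_grid_round [measurable]: "grid_round k \<in> borel_measurable borel"
proof -
  have "grid_round k = (\<lambda>z. of_real (of_int \<lfloor>Re z * real k\<rfloor> / real k) + \<i> * of_real (of_int \<lfloor>Im z * real k\<rfloor> / real k))"
    by (auto simp: grid_round_def complex_eq_iff)
  then show ?thesis by simp
qed

lemma norm_grid_round_diff:
  assumes "0 < k"
  shows "norm (z - grid_round k z) \<le> 2 / real k"
proof -
  have *: "\<bar>x - of_int \<lfloor>x * real k\<rfloor> / real k\<bar> \<le> 1 / real k" for x :: real
  proof -
    have "\<bar>x * real k - of_int \<lfloor>x * real k\<rfloor>\<bar> \<le> 1" by linarith
    moreover have "x - of_int \<lfloor>x * real k\<rfloor> / real k = (x * real k - of_int \<lfloor>x * real k\<rfloor>) / real k"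
      using assms by (simp add: diff_divide_distrib)
    ultimately show ?thesis by (simp add: abs_divide divide_right_mono)
  qed
  have "norm (z - grid_round k z) \<le> \<bar>Re (z - grid_round k z)\<bar> + \<bar>Im (z - grid_round k z)\<bar>"
    by (rule cmod_le)
  then show ?thesis using *[of "Re z"] *[of "Im z"] by (simp add: grid_round_def)
qed

lemma finite_grid_round:
  assumes "\<And>z. z \<in> Z \<Longrightarrow> norm z \<le> 1"
  shows "finite (grid_round k ` Z)"
proof (rule finite_subset)
  show "finite ((\<lambda>(a, b). Complex (of_int a / real k) (of_int b / real k)) ` ({- int k..int k} \<times> {- int k..int k}))"
    by blast
  have *: "\<lfloor>x * real k\<rfloor> \<in> {- int k..int k}" if "\<bar>x\<bar> \<le> 1" for x :: real
  proof -
    have "\<bar>x * real k\<bar> \<le> real k" using mult_right_mono[OF that, of "real k"] by (simp add: abs_mult)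
    then have "- real k \<le> x * real k" "x * real k \<le> real k" by linarith+
    then have "- int k \<le> \<lfloor>x * real k\<rfloor>" "\<lfloor>x * real k\<rfloor> \<le> int k" by linarith+
    then show ?thesis by (simp add: atLeastAtMost_iff)
  qed
  show "grid_round k ` Z \<subseteq> (\<lambda>(a, b). Complex (of_int a / real k) (of_int b / real k)) ` ({- int k..int k} \<times> {- int k..int k})"
  proof
    fix y assume "y \<in> grid_round k ` Z"
    then obtain z where z: "y = grid_round k z" "norm z \<le> 1" using assms by blast
    have "\<bar>Re z\<bar> \<le> 1" "\<bar>Im z\<bar> \<le> 1" using z(2) abs_Re_le_cmod[of z] abs_Im_le_cmod[of z] by linarith+
    then show "y \<in> (\<lambda>(a, b). Complex (of_int a / real k) (of_int b / real k)) ` ({- int k..int k} \<times> {- int k..int k})"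
      using * unfolding z(1) grid_round_def by (intro image_eqI[of _ _ "(\<lfloor>Re z * real k\<rfloor>, \<lfloor>Im z * real k\<rfloor>)"]) auto
  qed
qed

context interval_system_family begin

text \<open>The bound \<open>1 / 2\<close> leaves room for rounding: with mesh
  \<open>1 / (j + 4)\<close> the error is at most \<open>2 / (j + 4) \<le> 1 / 2\<close>, so the
  rounded functions stay in the unit ball, as the comparison of products requires.\<close>

lemma bounded_average:
  fixes g :: "'i \<Rightarrow> real \<Rightarrow> complex"
  assumes g: "\<And>i. i \<in> I \<Longrightarrow> g i \<in> borel_measurable leb01"
    and bound: "\<And>i x. i \<in> I \<Longrightarrow> norm (g i x) \<le> 1 / 2"
  shows "AE x in leb01. (\<lambda>N. (\<Sum>n<N. \<Prod>i\<in>I. g i ((T i ^^ n) x)) / of_nat N)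
    \<longlonglongrightarrow> (\<Prod>i\<in>I. \<integral>x. g i x \<partial>(\<mu> i))"
proof -
  define s where "s j i x = grid_round (j + 4) (g i x)" for j i x
  define e :: "nat \<Rightarrow> real" where "e j = 2 / real (j + 4)" for j
  have e: "0 \<le> e j" "e j \<le> 1 / 2" for j by (auto simp: e_def divide_simps)
  have e_lim: "e \<longlonglongrightarrow> 0"
    unfolding e_def by (intro LIMSEQ_ignore_initial_segment[of "\<lambda>j. 2 / real j" 0 4] lim_const_over_n)
  have diff: "norm (g i x - s j i x) \<le> e j" for j i x
    unfolding s_def e_def by (rule norm_grid_round_diff) simp
  have sb: "norm (s j i x) \<le> 1" if "i \<in> I" for j i x
    using norm_triangle_ineq4[of "g i x" "g i x - s j i x"] bound[OF that, of x] diff[of i x j] e(2)[of j] by simp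
  have sm: "s j i \<in> borel_measurable leb01" if "i \<in> I" for j i
    unfolding s_def using measurable_compose[OF g[OF that] borel_measurable_grid_round] .
  have conv: "AE x in leb01. \<forall>j. (\<lambda>N. (\<Sum>n<N. \<Prod>i\<in>I. s j i ((T i ^^ n) x)) / of_nat N)
    \<longlonglongrightarrow> (\<Prod>i\<in>I. \<integral>x. s j i x \<partial>(\<mu> i))"
  proof (subst AE_all_countable, intro allI)
    fix j
    show "AE x in leb01. (\<lambda>N. (\<Sum>n<N. \<Prod>i\<in>I. s j i ((T i ^^ n) x)) / of_nat N)
      \<longlonglongrightarrow> (\<Prod>i\<in>I. \<integral>x. s j i x \<partial>(\<mu> i))"
    proof (rule finite_range_average[where V="grid_round (j + 4) ` {z. norm z \<le> 1}"])
      show "s j i x \<in> grid_round (j + 4) ` {z. norm z \<le> 1}" if "i \<in> I" for i x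
        using bound[OF that, of x] unfolding s_def by (intro imageI) simp
    qed (auto intro: sm finite_grid_round)
  qed
  have lim: "(\<lambda>j. \<Prod>i\<in>I. \<integral>x. s j i x \<partial>(\<mu> i)) \<longlonglongrightarrow> (\<Prod>i\<in>I. \<integral>x. g i x \<partial>(\<mu> i))"
  proof (rule tendsto_prod)
    fix i assume i: "i \<in> I"
    interpret i: interval_system "T i" "\<mu> i" "P i" using i by (rule sys)
    have m: "g i \<in> borel_measurable (\<mu> i)" "s j i \<in> borel_measurable (\<mu> i)" for j
      using g[OF i] sm[OF i] measurable_cong_sets[OF i.sets_mu refl] by auto
    have ig: "integrable (\<mu> i) (g i)"
      using bound[OF i] m by (intro i.\<mu>.integrable_const_bound[where B="1 / 2"]) auto
    have ints: "integrable (\<mu> i) (s j i)" for j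
      using sb[OF i] m by (intro i.\<mu>.integrable_const_bound[where B=1]) auto
    have "norm ((\<integral>x. s j i x \<partial>(\<mu> i)) - (\<integral>x. g i x \<partial>(\<mu> i))) \<le> e j" for j
    proof -
      have "norm ((\<integral>x. s j i x \<partial>(\<mu> i)) - (\<integral>x. g i x \<partial>(\<mu> i))) = norm (\<integral>x. s j i x - g i x \<partial>(\<mu> i))"
        using ig ints by simp
      also have "\<dots> \<le> (\<integral>x. norm (s j i x - g i x) \<partial>(\<mu> i))" by (rule integral_norm_bound)
      also have "\<dots> \<le> (\<integral>x. e j \<partial>(\<mu> i))"
        using diff e(1) by (intro Bochner_Integration.integral_mono') (auto simp: norm_minus_commute)
      also have "\<dots> = e j" using i.\<mu>.prob_space by simp
      finally show ?thesis .
    qed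
    then have "(\<lambda>j. (\<integral>x. s j i x \<partial>(\<mu> i)) - (\<integral>x. g i x \<partial>(\<mu> i))) \<longlonglongrightarrow> 0"
      by (intro Lim_null_comparison[OF _ e_lim]) auto
    then show "(\<lambda>j. \<integral>x. s j i x \<partial>(\<mu> i)) \<longlonglongrightarrow> (\<integral>x. g i x \<partial>(\<mu> i))" by (rule LIM_zero_cancel)
  qed
  show ?thesis using conv
  proof eventually_elim
    case (elim x)
    show ?case
    proof (rule tendsto_of_approximations[OF _ lim])
      show "(\<lambda>N. (\<Sum>n<N. \<Prod>i\<in>I. s j i ((T i ^^ n) x)) / of_nat N) \<longlonglongrightarrow> (\<Prod>i\<in>I. \<integral>x. s j i x \<partial>(\<mu> i))" for j
        using elim by blast
      show "(\<lambda>j. real (card I) * e j) \<longlonglongrightarrow> 0" by (intro tendsto_mult_right_zero e_lim)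
      show "\<forall>\<^sub>F j in sequentially. \<forall>N. norm ((\<Sum>n<N. \<Prod>i\<in>I. g i ((T i ^^ n) x)) / of_nat N
          - (\<Sum>n<N. \<Prod>i\<in>I. s j i ((T i ^^ n) x)) / of_nat N) \<le> real (card I) * e j"
      proof (intro always_eventually allI norm_average_prod_diff)
        show "norm (g i ((T i ^^ n) x)) \<le> 1" if "i \<in> I" for i n using bound[OF that] by (rule order_trans) simp
        show "(\<Sum>n<N. norm (g i ((T i ^^ n) x) - s j i ((T i ^^ n) x))) \<le> e j * real N" for i j N
          using sum_bounded_above[of "{..<N}" _ "e j"] diff by (simp add: mult.commute)
      qed (use sb e(1) in auto)
    qed
  qed
qed

lemma L_infinity_average:
  fixes f :: "'i \<Rightarrow> real \<Rightarrow> complex"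
  assumes f: "\<And>i. i \<in> I \<Longrightarrow> f i \<in> L_infinity leb01"
  shows "AE x in leb01. (\<lambda>N. (\<Sum>n<N. \<Prod>i\<in>I. f i ((T i ^^ n) x)) / of_nat N)
    \<longlonglongrightarrow> (\<Prod>i\<in>I. \<integral>x. f i x \<partial>(\<mu> i))"
proof -
  have "\<forall>i\<in>I. \<exists>C. AE x in leb01. norm (f i x) \<le> C" using f by (auto simp: L_infinity_def)
  from bchoice[OF this] obtain C where C: "\<And>i. i \<in> I \<Longrightarrow> AE x in leb01. norm (f i x) \<le> C i" by blast
  \<comment> \<open>The maximum with 1 keeps the later divisor positive even if the essential bound
    is zero.\<close>
  define c where "c i = max 1 (C i)" for i
  have c: "0 < c i" for i by (simp add: c_def)
  \<comment> \<open>Truncation makes the bound hold everywhere, and the factor 2 brings it down to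
    \<open>1 / 2\<close>. The discarded values lie over a null set.\<close>
  define g where "g i x = (if norm (f i x) \<le> c i then f i x / of_real (2 * c i) else 0)" for i x
  have fm: "f i \<in> borel_measurable leb01" if "i \<in> I" for i using f[OF that] by (simp add: L_infinity_def)
  have gm: "g i \<in> borel_measurable leb01" if "i \<in> I" for i
  proof -
    note [measurable] = fm[OF that]
    show ?thesis unfolding g_def by measurable
  qed
  have gb: "norm (g i x) \<le> 1 / 2" for i x
    using c[of i] by (auto simp: g_def norm_divide norm_mult field_simps)
  have fg: "AE x in leb01. f i x = of_real (2 * c i) * g i x" if "i \<in> I" for i
    using C[OF that]
  proof eventually_elim
    case (elim x)
    then have "norm (f i x) \<le> c i" by (simp add: c_def)
    moreover have "complex_of_real (c i) \<noteq> 0" using c[of i] by simp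
    ultimately show ?case by (simp add: g_def)
  qed
  \<comment> \<open>The averages sample whole orbits, so equality almost everywhere is first carried
    along all iterates.\<close>
  have "AE x in leb01. \<forall>i\<in>I. \<forall>n. f i ((T i ^^ n) x) = of_real (2 * c i) * g i ((T i ^^ n) x)"
  proof (intro AE_finite_allI[OF finite_I])
    fix i assume i: "i \<in> I"
    show "AE x in leb01. \<forall>n. f i ((T i ^^ n) x) = of_real (2 * c i) * g i ((T i ^^ n) x)"
      unfolding AE_all_countable using interval_system.AE_iterate[OF sys[OF i] fg[OF i]] by blast
  qed
  moreover have "AE x in leb01. (\<lambda>N. (\<Sum>n<N. \<Prod>i\<in>I. g i ((T i ^^ n) x)) / of_nat N)
    \<longlonglongrightarrow> (\<Prod>i\<in>I. \<integral>x. g i x \<partial>(\<mu> i))" using gm gb by (rule bounded_average)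
  ultimately show ?thesis
  proof eventually_elim
    case (elim x)
    let ?c = "\<Prod>i\<in>I. complex_of_real (2 * c i)"
    have "(\<lambda>N. ?c * ((\<Sum>n<N. \<Prod>i\<in>I. g i ((T i ^^ n) x)) / of_nat N)) \<longlonglongrightarrow> ?c * (\<Prod>i\<in>I. \<integral>x. g i x \<partial>(\<mu> i))"
      by (intro tendsto_mult tendsto_const elim)
    also have "(\<lambda>N. ?c * ((\<Sum>n<N. \<Prod>i\<in>I. g i ((T i ^^ n) x)) / of_nat N))
        = (\<lambda>N. (\<Sum>n<N. \<Prod>i\<in>I. f i ((T i ^^ n) x)) / of_nat N)"
    proof
      fix N
      have "(\<Prod>i\<in>I. f i ((T i ^^ n) x)) = ?c * (\<Prod>i\<in>I. g i ((T i ^^ n) x))" for n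
        unfolding prod.distrib[symmetric] using elim(1) by (intro prod.cong) auto
      then show "?c * ((\<Sum>n<N. \<Prod>i\<in>I. g i ((T i ^^ n) x)) / of_nat N) = (\<Sum>n<N. \<Prod>i\<in>I. f i ((T i ^^ n) x)) / of_nat N"
        by (simp only: sum_distrib_left times_divide_eq_right)
    qed
    also have "?c * (\<Prod>i\<in>I. \<integral>x. g i x \<partial>(\<mu> i)) = (\<Prod>i\<in>I. \<integral>x. f i x \<partial>(\<mu> i))"
      unfolding prod.distrib[symmetric]
    proof (intro prod.cong refl)
      fix i assume i: "i \<in> I"
      interpret i: interval_system "T i" "\<mu> i" "P i" using i by (rule sys)
      have "(\<integral>x. f i x \<partial>(\<mu> i)) = (\<integral>x. of_real (2 * c i) * g i x \<partial>(\<mu> i))"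
        using fg[OF i] fm[OF i] gm[OF i] measurable_cong_sets[OF i.sets_mu refl]
        by (intro integral_cong_AE) (auto simp: i.AE_mu_iff)
      then show "of_real (2 * c i) * (\<integral>x. g i x \<partial>(\<mu> i)) = (\<integral>x. f i x \<partial>(\<mu> i))" by simp
    qed
    finally show ?case .
  qed
qed

end

theorem theorem1p10:
  fixes k :: nat
    and T :: "nat \<Rightarrow> real \<Rightarrow> real"
    and \<mu> :: "nat \<Rightarrow> real measure"
    and \<A> :: "nat \<Rightarrow> real set set"
    and f :: "nat \<Rightarrow> real \<Rightarrow> complex"
  assumes "k \<ge> 1"
    and "\<And>i. i \<in> {1..k} \<Longrightarrow> class_T (T i) (\<mu> i) (\<A> i)"
    and "\<And>i. i \<in> {1..k} \<Longrightarrow> property_E (T i) (\<mu> i) (\<A> i)"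
    and "\<And>i. i \<in> {1..k} \<Longrightarrow> property_M (T i) (\<mu> i) (\<A> i)"
    and "inj_on (\<lambda>i. ks_entropy (\<mu> i) (T i)) {1..k}"
    and "\<And>i. i \<in> {1..k} \<Longrightarrow> f i \<in> L_infinity leb01"
  shows "AE x in leb01.
    (\<lambda>N. 1 / of_nat N * (\<Sum>n<N. \<Prod>i=1..k. f i ((T i ^^ n) x)))
      \<longlonglongrightarrow> (\<Prod>i=1..k. \<integral>x. f i x \<partial>(\<mu> i))"
proof -
  interpret interval_system_family T \<mu> \<A> "{1..k}"
    using assms(2-5) by unfold_locales auto
  show ?thesis using L_infinity_average[of f] assms(6) by simp
qed

end
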